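(* Let $k\{Y\}=k\{y_1,\ldots,y_l\}$ be a ring of differential polynomials over a differential field $k$ of characteristic zero, with a fixed ranking. If $\mathbb{C}$ and $\mathbb{D}$ are two canonical characteristic sets of a characterizable differential ideal $I$, then $\mathbb{C}=\mathbb{D}$.
   Context: $\Delta=\{\delta_1,\ldots,\delta_n\}$ is a finite set of commuting derivations, $\Theta$ the free commutative monoid of derivative operators $\delta_1^{k_1}\cdots\delta_n^{k_n}$. $k\{Y\}$ is the polynomial ring over $k$ in the differential variables $\Theta Y=\{\theta y_j\}$. $[F]$ is the differential ideal generated by $F$. A ranking is a total order on $\Theta Y$ such that $\theta u\geq u$ and ($u\geq v\Rightarrow\theta u\geq\theta v$). The leader $u_f$ of $f\notin k$ is the highest differential variable in $f$; if $d=\deg_{u_f}f$, the initial $I_f$ is the coefficient of $u_f^d$, the separant is $S_f=\partial f/\partial u_f$, and the rank is $u_f^d$. Ranks are compared by $u^{d}>v^{e}$ iff $u>v$, or $u=v$ and $d>e$. $f$ is reduced with respect to $g$ if no proper derivative of $u_g$ appears in $f$ and $\deg_{u_g}f<\deg_{u_g}g$. A set $\mathbb{A}\subset k\{Y\}\setminus k$ is autoreduced if each element is reduced with respect to all the others; such sets are finite and written in order of increasing rank. $\mathbb{A}=A_1,\ldots,A_r$ has lower rank than $\mathbb{B}=B_1,\ldots,B_s$ if there is $j\le r,s$ with $\operatorname{rank}A_i=\operatorname{rank}B_i$ for $i<j$ and $\operatorname{rank}A_j<\operatorname{rank}B_j$, or if $r>s$ and $\operatorname{rank}A_i=\operatorname{rank}B_i$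 for $1\le i\le s$. A characteristic set of an ideal is an autoreduced subset of it of lowest rank. $H_{\mathbb{A}}$ is the product of the initials and separants of the elements of $\mathbb{A}$, and $J:H_{\mathbb{A}}^\infty=\{a : H_{\mathbb{A}}^m a\in J\text{ for some }m\geq0\}$. A differential ideal $I$ is characterizable if $I=[\mathbb{A}]:H_{\mathbb{A}}^\infty$ for some characteristic set $\mathbb{A}$ of $I$. $>_{\rm lex}$ is the lexicographic order on power products of differential variables induced by the ranking. A characteristic set $\mathbb{C}=C_1,\ldots,C_p$ of a characterizable ideal $I$, with set of leaders $L$ and non-leaders $N=\Theta Y\setminus\Theta L$, is canonical if (1) $I_{C_i}\in k[N]$ for all $i$; (2) for each $i$, $C_i$ has no factors in $k[N]$ (other than constants of $k$), and the coefficient in $I_{C_i}$ of its leading monomial with respect to $>_{\rm lex}$ equals $1$. (It is not part of the definition that $\mathbb{C}$ itself characterizes $I$.) *)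

theory Defs
  imports "HOL-Library.Poly_Mapping" "HOL.Hull"
begin

section \<open>Differential polynomials\<close>

text \<open>
  The finite type \<open>'d\<close> indexes the derivations \<open>\<delta>\<^sub>1, \<dots>, \<delta>\<^sub>n\<close> and the finite type \<open>'y\<close> indexes the
  differential indeterminates \<open>y\<^sub>1, \<dots>, y\<^sub>l\<close>.  A derivative operator is its exponent vector, so that
  composition is addition and the identity operator is \<open>0\<close>.
\<close>

type_synonym 'd diff_op = "'d \<Rightarrow>\<^sub>0 nat"
type_synonym ('d, 'y) dvar = "'d diff_op \<times> 'y"
type_synonym ('d, 'y) power_prod = "('d, 'y) dvar \<Rightarrow>\<^sub>0 nat"
type_synonym ('d, 'y, 'k) dpoly = "('d, 'y) power_prod \<Rightarrow>\<^sub>0 'k"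

definition apply_op :: "'d diff_op \<Rightarrow> ('d, 'y) dvar \<Rightarrow> ('d, 'y) dvar" where
  "apply_op \<theta> u = (\<theta> + fst u, snd u)"

definition Const :: "'k::zero \<Rightarrow> ('d, 'y, 'k) dpoly" where
  "Const c = Poly_Mapping.single 0 c"

definition Var :: "('d, 'y) dvar \<Rightarrow> ('d, 'y, 'k::zero_neq_one) dpoly" where
  "Var u = Poly_Mapping.single (Poly_Mapping.single u 1) 1"

definition constants :: "('d, 'y, 'k::zero) dpoly set" where
  "constants = {Const c | c. True}"

definition vars :: "('d, 'y, 'k::zero) dpoly \<Rightarrow> ('d, 'y) dvar set" where
  "vars f = (\<Union>m\<in>Poly_Mapping.keys f. Poly_Mapping.keys m)"

text \<open>The polynomial ring \<open>k[V]\<close> over a set \<open>V\<close> of differential variables.\<close>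

definition polys_in :: "('d, 'y) dvar set \<Rightarrow> ('d, 'y, 'k::zero) dpoly set" where
  "polys_in V = {f. vars f \<subseteq> V}"

definition deg_in :: "('d, 'y) dvar \<Rightarrow> ('d, 'y, 'k::zero) dpoly \<Rightarrow> nat" where
  "deg_in u f = Max (insert 0 ((\<lambda>m. Poly_Mapping.lookup m u) ` Poly_Mapping.keys f))"

text \<open>The coefficient of \<open>u\<^sup>e\<close> when \<open>f\<close> is regarded as a univariate polynomial in \<open>u\<close>.\<close>

definition coeff_in ::
  "('d, 'y) dvar \<Rightarrow> nat \<Rightarrow> ('d, 'y, 'k::comm_monoid_add) dpoly \<Rightarrow> ('d, 'y, 'k) dpoly" where
  "coeff_in u e f =
    (\<Sum>m | m \<in> Poly_Mapping.keys f \<and> Poly_Mapping.lookup m u = e.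
       Poly_Mapping.single (m - Poly_Mapping.single u e) (Poly_Mapping.lookup f m))"

definition partial_deriv ::
  "('d, 'y) dvar \<Rightarrow> ('d, 'y, 'k::comm_semiring_1) dpoly \<Rightarrow> ('d, 'y, 'k) dpoly" where
  "partial_deriv u f =
    (\<Sum>m\<in>Poly_Mapping.keys f.
       Poly_Mapping.single (m - Poly_Mapping.single u 1)
         (of_nat (Poly_Mapping.lookup m u) * Poly_Mapping.lookup f m))"

definition derivation :: "('a::semiring \<Rightarrow> 'a) \<Rightarrow> bool" where
  "derivation D \<longleftrightarrow>
    (\<forall>a b. D (a + b) = D a + D b) \<and> (\<forall>a b. D (a * b) = D a * b + a * D b)"

text \<open>
  The extension of the derivation \<open>\<delta> i\<close> of \<open>k\<close> to \<open>k{Y}\<close>: differentiate the coefficients, and apply the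
  chain rule with \<open>u \<mapsto> \<delta>\<^sub>i u\<close> on the differential variables.
\<close>

definition dderiv ::
  "('d \<Rightarrow> 'k \<Rightarrow> 'k) \<Rightarrow> 'd \<Rightarrow> ('d, 'y, 'k::comm_semiring_1) dpoly \<Rightarrow> ('d, 'y, 'k) dpoly" where
  "dderiv \<delta> i f =
    Poly_Mapping.map (\<delta> i) f +
    (\<Sum>u\<in>vars f. partial_deriv u f * Var (apply_op (Poly_Mapping.single i 1) u))"

definition differential_ideal ::
  "('d \<Rightarrow> 'k \<Rightarrow> 'k) \<Rightarrow> ('d, 'y, 'k::comm_ring_1) dpoly set \<Rightarrow> bool" where
  "differential_ideal \<delta> J \<longleftrightarrow>
    0 \<in> J \<and> (\<forall>f\<in>J. \<forall>g\<in>J. f + g \<in> J) \<and> (\<forall>f. \<forall>g\<in>J. f * g \<in> J) \<and>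
    (\<forall>i. \<forall>f\<in>J. dderiv \<delta> i f \<in> J)"

definition diff_ideal_gen ::
  "('d \<Rightarrow> 'k \<Rightarrow> 'k) \<Rightarrow> ('d, 'y, 'k::comm_ring_1) dpoly set \<Rightarrow> ('d, 'y, 'k) dpoly set" where
  "diff_ideal_gen \<delta> F = differential_ideal \<delta> hull F"

definition saturation :: "'a::comm_semiring_1 set \<Rightarrow> 'a \<Rightarrow> 'a set" where
  "saturation J h = {a. \<exists>m::nat. h ^ m * a \<in> J}"


section \<open>Rankings, leaders and reduction\<close>

text \<open>A ranking is given by its non-strict order relation \<open>le\<close>.\<close>

definition strict :: "('a \<Rightarrow> 'a \<Rightarrow> bool) \<Rightarrow> 'a \<Rightarrow> 'a \<Rightarrow> bool" where
  "strict le u v \<longleftrightarrow> le u v \<and> \<not> le v u"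

definition ranking :: "(('d, 'y) dvar \<Rightarrow> ('d, 'y) dvar \<Rightarrow> bool) \<Rightarrow> bool" where
  "ranking le \<longleftrightarrow>
    class.linorder le (strict le) \<and>
    (\<forall>\<theta> u. le u (apply_op \<theta> u)) \<and>
    (\<forall>\<theta> u v. le v u \<longrightarrow> le (apply_op \<theta> v) (apply_op \<theta> u))"

text \<open>The following notions are only meaningful for \<open>f \<notin> k\<close>.\<close>

definition leader ::
  "(('d, 'y) dvar \<Rightarrow> ('d, 'y) dvar \<Rightarrow> bool) \<Rightarrow> ('d, 'y, 'k::zero) dpoly \<Rightarrow> ('d, 'y) dvar" where
  "leader le f = (THE u. u \<in> vars f \<and> (\<forall>v\<in>vars f. le v u))"

definition rank ::
  "(('d, 'y) dvar \<Rightarrow> ('d, 'y) dvar \<Rightarrow> bool) \<Rightarrow> ('d, 'y, 'k::zero) dpoly \<Rightarrow> ('d, 'y) dvar \<times> nat" where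
  "rank le f = (leader le f, deg_in (leader le f) f)"

definition initial ::
  "(('d, 'y) dvar \<Rightarrow> ('d, 'y) dvar \<Rightarrow> bool) \<Rightarrow>
    ('d, 'y, 'k::comm_monoid_add) dpoly \<Rightarrow> ('d, 'y, 'k) dpoly" where
  "initial le f = coeff_in (leader le f) (deg_in (leader le f) f) f"

definition separant ::
  "(('d, 'y) dvar \<Rightarrow> ('d, 'y) dvar \<Rightarrow> bool) \<Rightarrow>
    ('d, 'y, 'k::comm_semiring_1) dpoly \<Rightarrow> ('d, 'y, 'k) dpoly" where
  "separant le f = partial_deriv (leader le f) f"

definition rank_less ::
  "(('d, 'y) dvar \<Rightarrow> ('d, 'y) dvar \<Rightarrow> bool) \<Rightarrow>
    ('d, 'y) dvar \<times> nat \<Rightarrow> ('d, 'y) dvar \<times> nat \<Rightarrow> bool" where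
  "rank_less le p q \<longleftrightarrow> strict le (fst p) (fst q) \<or> fst p = fst q \<and> snd p < snd q"

definition reduced_wrt ::
  "(('d, 'y) dvar \<Rightarrow> ('d, 'y) dvar \<Rightarrow> bool) \<Rightarrow>
    ('d, 'y, 'k::zero) dpoly \<Rightarrow> ('d, 'y, 'k) dpoly \<Rightarrow> bool" where
  "reduced_wrt le f g \<longleftrightarrow>
    (\<forall>\<theta>. \<theta> \<noteq> 0 \<longrightarrow> apply_op \<theta> (leader le g) \<notin> vars f) \<and>
    deg_in (leader le g) f < deg_in (leader le g) g"

definition autoreduced ::
  "(('d, 'y) dvar \<Rightarrow> ('d, 'y) dvar \<Rightarrow> bool) \<Rightarrow> ('d, 'y, 'k::zero) dpoly set \<Rightarrow> bool" where
  "autoreduced le A \<longleftrightarrow>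
    A \<inter> constants = {} \<and> (\<forall>f\<in>A. \<forall>g\<in>A. f \<noteq> g \<longrightarrow> reduced_wrt le f g)"


section \<open>Characteristic sets\<close>

text \<open>
  An autoreduced set is finite and its elements have pairwise different ranks, so it has exactly one
  enumeration by increasing rank.
\<close>

definition rank_enum ::
  "(('d, 'y) dvar \<Rightarrow> ('d, 'y) dvar \<Rightarrow> bool) \<Rightarrow>
    ('d, 'y, 'k::zero) dpoly set \<Rightarrow> ('d, 'y, 'k) dpoly list \<Rightarrow> bool" where
  "rank_enum le A as \<longleftrightarrow>
    set as = A \<and> sorted_wrt (\<lambda>f g. rank_less le (rank le f) (rank le g)) as"

definition list_lower_rank ::
  "(('d, 'y) dvar \<Rightarrow> ('d, 'y) dvar \<Rightarrow> bool) \<Rightarrow>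
    ('d, 'y, 'k::zero) dpoly list \<Rightarrow> ('d, 'y, 'k) dpoly list \<Rightarrow> bool" where
  "list_lower_rank le as bs \<longleftrightarrow>
    (\<exists>j. j < length as \<and> j < length bs \<and>
       (\<forall>i<j. rank le (as ! i) = rank le (bs ! i)) \<and>
       rank_less le (rank le (as ! j)) (rank le (bs ! j))) \<or>
    (length as > length bs \<and> (\<forall>i<length bs. rank le (as ! i) = rank le (bs ! i)))"

definition lower_rank ::
  "(('d, 'y) dvar \<Rightarrow> ('d, 'y) dvar \<Rightarrow> bool) \<Rightarrow>
    ('d, 'y, 'k::zero) dpoly set \<Rightarrow> ('d, 'y, 'k) dpoly set \<Rightarrow> bool" where
  "lower_rank le A B \<longleftrightarrow>
    (\<exists>as bs. rank_enum le A as \<and> rank_enum le B bs \<and> list_lower_rank le as bs)"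

definition characteristic_set ::
  "(('d, 'y) dvar \<Rightarrow> ('d, 'y) dvar \<Rightarrow> bool) \<Rightarrow>
    ('d, 'y, 'k::zero) dpoly set \<Rightarrow> ('d, 'y, 'k) dpoly set \<Rightarrow> bool" where
  "characteristic_set le J A \<longleftrightarrow>
    autoreduced le A \<and> A \<subseteq> J \<and> (\<forall>B. autoreduced le B \<and> B \<subseteq> J \<longrightarrow> \<not> lower_rank le B A)"

definition init_sep_prod ::
  "(('d, 'y) dvar \<Rightarrow> ('d, 'y) dvar \<Rightarrow> bool) \<Rightarrow>
    ('d, 'y, 'k::comm_semiring_1) dpoly set \<Rightarrow> ('d, 'y, 'k) dpoly" where
  "init_sep_prod le A = (\<Prod>f\<in>A. initial le f * separant le f)"

definition characterizable ::
  "('d \<Rightarrow> 'k \<Rightarrow> 'k) \<Rightarrow> (('d, 'y) dvar \<Rightarrow> ('d, 'y) dvar \<Rightarrow> bool) \<Rightarrow>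
    ('d, 'y, 'k::comm_ring_1) dpoly set \<Rightarrow> bool" where
  "characterizable \<delta> le J \<longleftrightarrow>
    differential_ideal \<delta> J \<and>
    (\<exists>A. characteristic_set le J A \<and>
         J = saturation (diff_ideal_gen \<delta> A) (init_sep_prod le A))"


section \<open>Canonical characteristic sets\<close>

definition lex_less ::
  "(('d, 'y) dvar \<Rightarrow> ('d, 'y) dvar \<Rightarrow> bool) \<Rightarrow>
    ('d, 'y) power_prod \<Rightarrow> ('d, 'y) power_prod \<Rightarrow> bool" where
  "lex_less le m m' \<longleftrightarrow>
    (\<exists>u. Poly_Mapping.lookup m u < Poly_Mapping.lookup m' u \<and>
         (\<forall>v. strict le u v \<longrightarrow> Poly_Mapping.lookup m v = Poly_Mapping.lookup m' v))"

definition lex_leading_monomial ::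
  "(('d, 'y) dvar \<Rightarrow> ('d, 'y) dvar \<Rightarrow> bool) \<Rightarrow>
    ('d, 'y, 'k::zero) dpoly \<Rightarrow> ('d, 'y) power_prod" where
  "lex_leading_monomial le f =
    (THE m. m \<in> Poly_Mapping.keys f \<and> (\<forall>m'\<in>Poly_Mapping.keys f. m' \<noteq> m \<longrightarrow> lex_less le m' m))"

definition lex_leading_coeff ::
  "(('d, 'y) dvar \<Rightarrow> ('d, 'y) dvar \<Rightarrow> bool) \<Rightarrow> ('d, 'y, 'k::zero) dpoly \<Rightarrow> 'k" where
  "lex_leading_coeff le f = Poly_Mapping.lookup f (lex_leading_monomial le f)"

definition non_leaders ::
  "(('d, 'y) dvar \<Rightarrow> ('d, 'y) dvar \<Rightarrow> bool) \<Rightarrow>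
    ('d, 'y, 'k::zero) dpoly set \<Rightarrow> ('d, 'y) dvar set" where
  "non_leaders le C = UNIV - {apply_op \<theta> (leader le f) | \<theta> f. f \<in> C}"

definition canonical_characteristic_set ::
  "(('d, 'y) dvar \<Rightarrow> ('d, 'y) dvar \<Rightarrow> bool) \<Rightarrow>
    ('d, 'y, 'k::comm_ring_1) dpoly set \<Rightarrow> ('d, 'y, 'k) dpoly set \<Rightarrow> bool" where
  "canonical_characteristic_set le J C \<longleftrightarrow>
    characteristic_set le J C \<and>
    (\<forall>f\<in>C. initial le f \<in> polys_in (non_leaders le C) \<and>
           (\<forall>g\<in>polys_in (non_leaders le C). g dvd f \<longrightarrow> g \<in> constants) \<and>
           lex_leading_coeff le (initial le f) = 1)"

end

theory Submission
  imports Defs "HOL-Computational_Algebra.Factorial_Ring" "HOL.Topological_Spaces"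
begin

text \<open>
  All characteristic sets of \<open>I\<close> have the same ranks, so \<open>\<C>\<close> and \<open>\<D>\<close> have the same non-leaders \<open>N\<close>
  and their elements can be matched by rank.  If \<open>f \<in> \<C>\<close> and \<open>g \<in> \<D>\<close> have the same rank, then
  \<open>I\<^sub>g f - I\<^sub>f g\<close> lies in \<open>I\<close> and is reduced with respect to \<open>\<C>\<close>, hence is a constant; it is \<open>0\<close> because
  a characterizable ideal is proper.  As \<open>f\<close> and \<open>g\<close> have no nonconstant factor in \<open>k[N]\<close>, unique
  factorization turns \<open>I\<^sub>g f = I\<^sub>f g\<close> into \<open>I\<^sub>f | I\<^sub>g\<close> and \<open>I\<^sub>g | I\<^sub>f\<close>, and the normalization of the
  leading coefficients gives \<open>I\<^sub>f = I\<^sub>g\<close>, so \<open>f = g\<close>.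

  Unique factorization is proved for \<open>k[V]\<close> by induction on the finite set \<open>V\<close>: differential variables
  carry no linear order in the type class sense, so \<open>dpoly\<close> is not an instance of \<open>idom\<close>.
\<close>

section \<open>Coefficients, degrees and variables\<close>

text \<open>The unit ideal has to be excluded by an argument of its own: autoreduced sets contain no
  constants, so it too has characteristic sets, and for one indeterminate \<open>{y}\<close> and
  \<open>{y + 1}\<close> would both be canonical for it. What separates it from the ideals
  considered is the equation \<open>I = [A] : H^\<infinity>\<close>. The derivations and their
  commutation enter when this equation is refuted: a point over \<open>k\<close> that respects them
  is a zero of all of \<open>[A]\<close>, but not of the powers of \<open>H\<close>.

  Irreducible polynomials are shown to be prime without fraction fields or greatest common divisors.
  Pseudo-division stands in for division and leaves powers of a leading coefficient behind; these
  are split off one irreducible factor at a time. No complete factorization is ever formed.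

  The two conditions of canonicity meet in one place: a common divisor of an initial and of an
  element of the set lies in \<open>k[N]\<close> because the initial does, and is constant because
  the element has no other factors there.\<close>

lemma poly_mapping_induct [case_names zero single add]:
  assumes "P 0" and "\<And>m c. P (Poly_Mapping.single m c)"
    and "\<And>f g. P f \<Longrightarrow> P g \<Longrightarrow> P (f + g)"
  shows "P (f :: 'a \<Rightarrow>\<^sub>0 'b::comm_monoid_add)"
proof (induction f rule: Poly_Mapping.update_induct)
  case const
  show ?case by (fact assms(1))
next
  case (update f a b)
  have "Poly_Mapping.update a b f = f + Poly_Mapping.single a b"
    using update(1)
    by (intro poly_mapping_eqI) (auto simp: lookup_update lookup_add lookup_single in_keys_iff when_def)
  with assms(2,3) update show ?case by simp
qed

text \<open>Subtraction of exponents truncates at 0, so it undoes multiplication by a power of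
  \<open>u\<close> only under control of the exponent of \<open>u\<close>. This is the bijection
  between terms of degree exactly \<open>e\<close> in \<open>u\<close> and terms free of
  \<open>u\<close>.\<close>

lemma eq_add_single_iff:
  fixes m n :: "'a \<Rightarrow>\<^sub>0 nat"
  assumes "Poly_Mapping.lookup n u = 0"
  shows "m = n + Poly_Mapping.single u e \<longleftrightarrow>
    Poly_Mapping.lookup m u = e \<and> m - Poly_Mapping.single u e = n"
  using assms
  by (auto simp: poly_mapping_eq_iff fun_eq_iff lookup_add lookup_minus lookup_single when_def)

text \<open>Each monomial free of \<open>u\<close> comes from exactly one term of degree
  \<open>e\<close>, so the defining sum collapses. Most facts about \<open>coeff_in\<close> are
  derived from this formula.\<close>

lemma lookup_coeff_in:
  "Poly_Mapping.lookup (coeff_in u e f) m =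
    (if Poly_Mapping.lookup m u = 0 then Poly_Mapping.lookup f (m + Poly_Mapping.single u e) else 0)"
proof -
  let ?S = "{n. n \<in> Poly_Mapping.keys f \<and> Poly_Mapping.lookup n u = e}"
  have fin: "finite ?S" by simp
  have eq: "n - Poly_Mapping.single u e = m \<longleftrightarrow>
      Poly_Mapping.lookup m u = 0 \<and> n = m + Poly_Mapping.single u e" if "n \<in> ?S" for n
    using that eq_add_single_iff[of m u n e] by (auto simp: lookup_minus)
  have "Poly_Mapping.lookup (coeff_in u e f) m =
      (\<Sum>n\<in>?S. Poly_Mapping.lookup f n when n - Poly_Mapping.single u e = m)"
    by (simp add: coeff_in_def lookup_sum lookup_single)
  also have "\<dots> = (\<Sum>n\<in>?S. if n = m + Poly_Mapping.single u e then
      (if Poly_Mapping.lookup m u = 0 then Poly_Mapping.lookup f n else 0) else 0)"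
    by (rule sum.cong[OF refl]) (use eq in \<open>auto simp: when_def\<close>)
  also have "\<dots> = (if Poly_Mapping.lookup m u = 0
      then Poly_Mapping.lookup f (m + Poly_Mapping.single u e) else 0)"
    using fin by (auto simp: sum.delta lookup_add in_keys_iff)
  finally show ?thesis .
qed

lemma coeff_in_add: "coeff_in u e (f + g) = coeff_in u e f + coeff_in u e g"
  by (rule poly_mapping_eqI) (simp add: lookup_coeff_in lookup_add)

lemma coeff_in_diff:
  "coeff_in u e (f - g) = coeff_in u e f - coeff_in u e (g :: ('d, 'y, 'k::comm_ring_1) dpoly)"
  by (rule poly_mapping_eqI) (simp add: lookup_coeff_in lookup_minus)

lemma coeff_in_zero [simp]: "coeff_in u e 0 = 0"
  by (rule poly_mapping_eqI) (simp add: lookup_coeff_in)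

lemma coeff_in_single:
  "coeff_in u e (Poly_Mapping.single m c) =
    (if Poly_Mapping.lookup m u = e then Poly_Mapping.single (m - Poly_Mapping.single u e) c else 0)"
proof -
  have "m = n + Poly_Mapping.single u e \<longleftrightarrow>
      Poly_Mapping.lookup m u = e \<and> m - Poly_Mapping.single u e = n"
    if "Poly_Mapping.lookup n u = 0" for n
    using that by (rule eq_add_single_iff)
  moreover have "Poly_Mapping.lookup n u = 0"
    if "Poly_Mapping.lookup m u = e" "m - Poly_Mapping.single u e = n" for n
    using that by (auto simp: lookup_minus)
  ultimately show ?thesis
    by (intro poly_mapping_eqI) (auto simp: lookup_coeff_in lookup_single when_def)
qed

text \<open>The Cauchy product. Both sides are additive in each factor, and for two single terms at
  most one summand survives, the one whose index is the exponent of \<open>u\<close> in the first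
  term.\<close>

lemma coeff_in_mult:
  "coeff_in u e (f * g) = (\<Sum>i\<le>e. coeff_in u i f * coeff_in u (e - i) g)"
  for f g :: "('d, 'y, 'k::comm_ring_1) dpoly"
proof (induction f rule: poly_mapping_induct)
  case (single m c)
  show ?case
  proof (induction g rule: poly_mapping_induct)
    case (single n d)
    have *: "(\<Sum>i\<le>e. coeff_in u i (Poly_Mapping.single m c) * coeff_in u (e - i) (Poly_Mapping.single n d))
      = (\<Sum>i\<le>e. if i = Poly_Mapping.lookup m u then
           (if Poly_Mapping.lookup m u + Poly_Mapping.lookup n u = e then
          Poly_Mapping.single (m + n - Poly_Mapping.single u e) (c * d) else 0) else 0)"
    proof (rule sum.cong[OF refl])
      fix i assume i: "i \<in> {..e}"
      have "m - Poly_Mapping.single u (Poly_Mapping.lookup m u) + (n - Poly_Mapping.single u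
          (Poly_Mapping.lookup n u))
          = m + n - Poly_Mapping.single u (Poly_Mapping.lookup m u + Poly_Mapping.lookup n u)"
        by (rule poly_mapping_eqI) (auto simp: lookup_add lookup_minus lookup_single when_def)
      then show "coeff_in u i (Poly_Mapping.single m c) * coeff_in u (e - i) (Poly_Mapping.single n d) =
          (if i = Poly_Mapping.lookup m u then
           (if Poly_Mapping.lookup m u + Poly_Mapping.lookup n u = e then
          Poly_Mapping.single (m + n - Poly_Mapping.single u e) (c * d) else 0) else 0)"
        using i by (auto simp: coeff_in_single mult_single)
    qed
    show ?case
      unfolding * by (auto simp: mult_single coeff_in_single sum.delta lookup_add)
  qed (simp_all add: coeff_in_add distrib_left sum.distrib)
qed (simp_all add: coeff_in_add distrib_right sum.distrib)

section \<open>Degree in one variable\<close>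

lemma deg_in_le_iff: "deg_in u f \<le> n \<longleftrightarrow> (\<forall>m\<in>Poly_Mapping.keys f. Poly_Mapping.lookup m u \<le> n)"
  by (simp add: deg_in_def)

lemma coeff_in_eq_0_iff:
  "coeff_in u e f = 0 \<longleftrightarrow> (\<forall>m\<in>Poly_Mapping.keys f. Poly_Mapping.lookup m u \<noteq> e)"
proof
  assume z: "coeff_in u e f = 0"
  show "\<forall>m\<in>Poly_Mapping.keys f. Poly_Mapping.lookup m u \<noteq> e"
  proof (intro ballI notI)
    fix m assume m: "m \<in> Poly_Mapping.keys f" "Poly_Mapping.lookup m u = e"
    then have "m - Poly_Mapping.single u e + Poly_Mapping.single u e = m"
      by (intro poly_mapping_eqI) (auto simp: lookup_add lookup_minus lookup_single when_def)
    then have "Poly_Mapping.lookup (coeff_in u e f) (m - Poly_Mapping.single u e) = Poly_Mapping.lookup f m"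
      using m by (simp add: lookup_coeff_in lookup_minus)
    with z m show False by (simp add: in_keys_iff)
  qed
next
  assume *: "\<forall>m\<in>Poly_Mapping.keys f. Poly_Mapping.lookup m u \<noteq> e"
  show "coeff_in u e f = 0"
  proof (rule poly_mapping_eqI)
    fix m
    show "Poly_Mapping.lookup (coeff_in u e f) m = Poly_Mapping.lookup 0 m"
      using *[rule_format, of "m + Poly_Mapping.single u e"]
      by (cases "m + Poly_Mapping.single u e \<in> Poly_Mapping.keys f")
        (simp_all add: lookup_coeff_in lookup_add not_in_keys_iff_lookup_eq_zero)
  qed
qed

lemma deg_in_le_iff_coeff: "deg_in u f \<le> n \<longleftrightarrow> (\<forall>i>n. coeff_in u i f = 0)"
  unfolding deg_in_le_iff coeff_in_eq_0_iff by (metis linorder_not_le)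

lemma coeff_in_above_deg: "deg_in u f < i \<Longrightarrow> coeff_in u i f = 0"
  using deg_in_le_iff_coeff[of u f "deg_in u f"] by simp

text \<open>Positivity of \<open>n\<close> matters because the zero polynomial has degree 0 here:
  for \<open>n = 0\<close> it would satisfy only the right side.\<close>

lemma deg_in_less_iff_coeff: "0 < n \<Longrightarrow> deg_in u f < n \<longleftrightarrow> (\<forall>i\<ge>n. coeff_in u i f = 0)"
  using deg_in_le_iff_coeff[of u f "n - 1"] by (cases n) (simp_all add: less_Suc_eq_le Suc_le_eq)

lemma lead_coeff_in_nonzero:
  assumes "f \<noteq> 0" shows "coeff_in u (deg_in u f) f \<noteq> 0"
proof -
  have ne: "Poly_Mapping.keys f \<noteq> {}" using assms by simp
  then obtain m0 where "m0 \<in> Poly_Mapping.keys f" by blast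
  have "Max (insert 0 ((\<lambda>m. Poly_Mapping.lookup m u) ` Poly_Mapping.keys f))
      \<in> insert 0 ((\<lambda>m. Poly_Mapping.lookup m u) ` Poly_Mapping.keys f)"
    by (rule Max_in) auto
  then have "deg_in u f = 0 \<or> (\<exists>m\<in>Poly_Mapping.keys f. Poly_Mapping.lookup m u = deg_in u f)"
    unfolding deg_in_def[symmetric] by auto
  \<comment> \<open>The maximum may be the inserted default 0; then every term has degree 0 in
    \<open>u\<close>, and any of them attains it.\<close>
  moreover have "\<exists>m\<in>Poly_Mapping.keys f. Poly_Mapping.lookup m u = deg_in u f" if "deg_in u f = 0"
    using that deg_in_le_iff[of u f 0] \<open>m0 \<in> Poly_Mapping.keys f\<close> by auto
  ultimately show ?thesis by (auto simp: coeff_in_eq_0_iff)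
qed

lemma deg_in_zero [simp]: "deg_in u 0 = 0"
  by (simp add: deg_in_def)

lemma vars_zero [simp]: "vars 0 = {}"
  by (simp add: vars_def)

lemma finite_vars [simp]: "finite (vars f)"
  by (simp add: vars_def)

lemma in_vars_iff: "u \<in> vars f \<longleftrightarrow> deg_in u f > 0"
  using deg_in_le_iff[of u f 0] by (auto simp: vars_def in_keys_iff)

lemma not_in_vars_iff: "u \<notin> vars f \<longleftrightarrow> deg_in u f = 0"
  by (simp add: in_vars_iff)

lemma vars_add: "vars (f + g) \<subseteq> vars f \<union> vars g"
  using Poly_Mapping.keys_add[of f g] by (fastforce simp: vars_def)

lemma vars_diff: "vars (f - g) \<subseteq> vars f \<union> vars (g :: ('d, 'y, 'k::comm_ring_1) dpoly)"
proof -
  have "Poly_Mapping.keys (f - g) \<subseteq> Poly_Mapping.keys f \<union> Poly_Mapping.keys g"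
    by (auto simp: in_keys_iff lookup_minus)
  then show ?thesis by (fastforce simp: vars_def)
qed

lemma vars_mult: "vars (f * g) \<subseteq> vars f \<union> vars (g :: ('d, 'y, 'k::comm_ring_1) dpoly)"
proof
  fix u assume "u \<in> vars (f * g)"
  then obtain m where m: "m \<in> Poly_Mapping.keys (f * g)" "u \<in> Poly_Mapping.keys m"
    by (auto simp: vars_def)
  then obtain a b where "m = a + b" "a \<in> Poly_Mapping.keys f" "b \<in> Poly_Mapping.keys g"
    using Poly_Mapping.keys_mult[of f g] by blast
  with m show "u \<in> vars f \<union> vars g"
    using Poly_Mapping.keys_add[of a b] by (auto simp: vars_def)
qed

lemma vars_coeff_in: "vars (coeff_in u e f) \<subseteq> vars f - {u}"
proof
  fix v assume "v \<in> vars (coeff_in u e f)"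
  then obtain m where m: "Poly_Mapping.lookup (coeff_in u e f) m \<noteq> 0" "Poly_Mapping.lookup m v \<noteq> 0"
    by (auto simp: vars_def in_keys_iff)
  then have "Poly_Mapping.lookup m u = 0" "Poly_Mapping.lookup f (m + Poly_Mapping.single u e) \<noteq> 0"
    by (auto simp: lookup_coeff_in split: if_splits)
  with m show "v \<in> vars f - {u}"
    by (auto simp: vars_def in_keys_iff lookup_add intro!: bexI[of _ "m + Poly_Mapping.single u e"])
qed

lemma coeff_in_free:
  assumes "u \<notin> vars f"
  shows "coeff_in u e f = (if e = 0 then f else 0)"
proof (cases "e = 0")
  case True
  have "Poly_Mapping.lookup f m = 0" if "Poly_Mapping.lookup m u \<noteq> 0" for m
    using that assms by (metis UN_I in_keys_iff vars_def)
  then show ?thesis using True by (auto intro!: poly_mapping_eqI simp: lookup_coeff_in)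
next
  case False
  then show ?thesis using assms coeff_in_above_deg[of u f e] by (simp add: not_in_vars_iff)
qed

lemma coeff_in_mult_free:
  assumes "u \<notin> vars f"
  shows "coeff_in u e (f * g) = f * coeff_in u e (g :: ('d, 'y, 'k::comm_ring_1) dpoly)"
proof -
  have "coeff_in u e (f * g) = (\<Sum>i\<le>e. if i = 0 then f * coeff_in u e g else 0)"
    unfolding coeff_in_mult by (rule sum.cong) (auto simp: coeff_in_free[OF assms])
  then show ?thesis by simp
qed

text \<open>Upper bounds instead of exact degrees, because pseudo-division multiplies by a term for
  which only a bound is at hand.\<close>

lemma coeff_in_mult_top:
  assumes "deg_in u f \<le> a" "deg_in u g \<le> b"
  shows "coeff_in u (a + b) (f * g) = coeff_in u a f * coeff_in u b (g :: ('d, 'y, 'k::comm_ring_1) dpoly)"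
proof -
  have "coeff_in u (a + b) (f * g) = (\<Sum>i\<le>a + b. if i = a then coeff_in u a f * coeff_in u b g else 0)"
    unfolding coeff_in_mult
  proof (rule sum.cong[OF refl])
    fix i assume "i \<in> {..a + b}"
    then consider "i = a" | "i > a" | "i < a" "a + b - i > b" by fastforce
    then show "coeff_in u i f * coeff_in u (a + b - i) g = (if i = a then coeff_in u a f * coeff_in u b
        g else 0)"
      by cases (use assms coeff_in_above_deg[of u f i] coeff_in_above_deg[of u g "a + b - i"] in auto)
  qed
  then show ?thesis by simp
qed

lemma deg_in_mult_le: "deg_in u (f * g) \<le> deg_in u f + deg_in u (g :: ('d, 'y, 'k::comm_ring_1) dpoly)"
  unfolding deg_in_le_iff_coeff coeff_in_mult
proof (intro allI impI sum.neutral ballI)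
  fix e i assume "deg_in u f + deg_in u g < e" "i \<in> {..e}"
  then have "deg_in u f < i \<or> deg_in u g < e - i" by auto
  then show "coeff_in u i f * coeff_in u (e - i) g = 0"
    by (auto simp: coeff_in_above_deg)
qed

lemma deg_in_diff_le: "deg_in u (f - g) \<le> max (deg_in u f) (deg_in u (g :: ('d, 'y, 'k::comm_ring_1) dpoly))"
  unfolding deg_in_le_iff_coeff by (auto simp: coeff_in_diff coeff_in_above_deg)

section \<open>Constants, absence of zero divisors, units\<close>

lemma Const_eq_0_iff [simp]: "Const c = 0 \<longleftrightarrow> c = 0"
  by (metis Const_def lookup_single_eq lookup_zero single_zero)

lemma Const_0 [simp]: "Const 0 = 0"
  and Const_1 [simp]: "Const 1 = 1"
  and Const_mult: "Const (a * b) = Const a * Const b"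
  for a b :: "'k::comm_ring_1"
  by (simp_all add: Const_def mult_single)

lemma Const_eq_iff [simp]: "Const a = Const b \<longleftrightarrow> a = b"
  by (metis Const_def lookup_single_eq)

lemma vars_eq_empty_iff: "vars f = {} \<longleftrightarrow> f \<in> constants"
proof
  assume "vars f = {}"
  have "Poly_Mapping.lookup f m = 0" if "m \<noteq> 0" for m
  proof -
    obtain v where "v \<in> Poly_Mapping.keys m" using \<open>m \<noteq> 0\<close> keys_eq_empty[of m] by blast
    with \<open>vars f = {}\<close> show ?thesis by (metis UN_I empty_iff in_keys_iff vars_def)
  qed
  then have "f = Const (Poly_Mapping.lookup f 0)"
    by (intro poly_mapping_eqI) (auto simp: Const_def lookup_single when_def)
  then show "f \<in> constants" by (auto simp: constants_def)
qed (auto simp: constants_def Const_def vars_def split: if_splits)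

lemma vars_Const [simp]: "vars (Const c) = {}"
  by (auto simp: vars_eq_empty_iff constants_def)

lemma vars_one [simp]: "vars (1 :: ('d, 'y, 'k::comm_ring_1) dpoly) = {}"
  by (metis Const_1 vars_Const)

text \<open>Induction on a finite set containing the variables of both factors: the leading
  coefficients with respect to one variable \<open>x\<close> are nonzero and involve fewer
  variables, and their product is a coefficient of \<open>f * g\<close>. The induction ends in the
  field \<open>k\<close>.\<close>

lemma mpoly_mult_nonzero:
  assumes "f \<noteq> 0" "g \<noteq> 0"
  shows "f * g \<noteq> (0 :: ('d, 'y, 'k::field) dpoly)"
proof -
  have "f * g \<noteq> 0" if "finite V" "vars f \<subseteq> V" "vars g \<subseteq> V" "f \<noteq> 0" "g \<noteq> 0"
    for V and f g :: "('d, 'y, 'k) dpoly"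
    using that
  proof (induction V arbitrary: f g)
    case empty
    then obtain a b where "f = Const a" "g = Const b"
      using vars_eq_empty_iff[of f] vars_eq_empty_iff[of g] by (auto simp: constants_def)
    with empty show ?case by (metis Const_0 Const_eq_iff Const_mult mult_eq_0_iff)
  next
    case (insert x V)
    have "coeff_in x (deg_in x f + deg_in x g) (f * g)
        = coeff_in x (deg_in x f) f * coeff_in x (deg_in x g) g"
      by (rule coeff_in_mult_top) auto
    also have "\<dots> \<noteq> 0"
      using insert.prems
      by (intro insert.IH lead_coeff_in_nonzero) (auto dest!: vars_coeff_in[THEN subsetD])
    finally show ?case by auto
  qed
  from this[of "vars f \<union> vars g" f g] assms show ?thesis by simp
qed

lemma mpoly_mult_left_cancel:
  assumes "c \<noteq> 0" "c * f = c * (g :: ('d, 'y, 'k::field) dpoly)"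
  shows "f = g"
proof -
  have "c * (f - g) = 0" using assms by (simp add: right_diff_distrib)
  with mpoly_mult_nonzero[OF assms(1)] show ?thesis by (metis right_minus_eq)
qed

lemma deg_in_mult:
  assumes "f \<noteq> 0" "g \<noteq> (0 :: ('d, 'y, 'k::field) dpoly)"
  shows "deg_in u (f * g) = deg_in u f + deg_in u g"
proof (rule antisym[OF deg_in_mult_le], rule ccontr)
  assume "\<not> deg_in u f + deg_in u g \<le> deg_in u (f * g)"
  then have "coeff_in u (deg_in u f + deg_in u g) (f * g) = 0" by (intro coeff_in_above_deg) simp
  then show False
    using assms by (simp add: coeff_in_mult_top mpoly_mult_nonzero lead_coeff_in_nonzero)
qed

lemma vars_mult_eq:
  assumes "f \<noteq> 0" "g \<noteq> (0 :: ('d, 'y, 'k::field) dpoly)"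
  shows "vars (f * g) = vars f \<union> vars g"
  using assms by (auto simp: in_vars_iff deg_in_mult)

lemma vars_dvd_subset:
  assumes "f dvd g" "g \<noteq> (0 :: ('d, 'y, 'k::field) dpoly)"
  shows "vars f \<subseteq> vars g"
proof -
  obtain h where "g = f * h" using assms(1) by (rule dvdE)
  moreover from this have "f \<noteq> 0" "h \<noteq> 0" using assms(2) by auto
  ultimately show ?thesis using vars_mult_eq[of f h] by blast
qed

lemma unit_iff_constant:
  "f dvd 1 \<longleftrightarrow> f \<noteq> 0 \<and> f \<in> constants" for f :: "('d, 'y, 'k::field) dpoly"
proof
  assume "f dvd 1"
  then have "vars f \<subseteq> vars (1 :: ('d, 'y, 'k) dpoly)" by (rule vars_dvd_subset) simp
  then show "f \<noteq> 0 \<and> f \<in> constants" using \<open>f dvd 1\<close> by (auto simp: vars_eq_empty_iff)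
next
  assume "f \<noteq> 0 \<and> f \<in> constants"
  then obtain c where "f = Const c" "c \<noteq> 0" by (auto simp: constants_def)
  then have "1 = f * Const (inverse c)" by (simp flip: Const_mult)
  then show "f dvd 1" by (rule dvdI)
qed

lemma coeff_in_times_power:
  fixes c :: "('d, 'y, 'k::comm_ring_1) dpoly"
  assumes "x \<notin> vars c"
  shows "coeff_in x i (c * Poly_Mapping.single (Poly_Mapping.single x n) 1) = (if i = n then c else 0)"
  using assms
  by (auto simp: coeff_in_mult_free coeff_in_single)

lemma vars_single_power: "vars (Poly_Mapping.single (Poly_Mapping.single x n) (c::'k::zero)) \<subseteq> {x}"
  by (auto simp: vars_def split: if_splits)

section \<open>Unique factorization\<close>

text \<open>The sum of the degrees in the single variables, not the largest degree of a monomial. It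
  is additive on nonzero products because each \<open>deg_in\<close> is, and positive exactly off
  the constants, so proper factors get smaller.\<close>

definition total_deg :: "('d, 'y, 'k::zero) dpoly \<Rightarrow> nat" where
  "total_deg f = (\<Sum>u\<in>vars f. deg_in u f)"

lemma total_deg_eq:
  assumes "finite V" "vars f \<subseteq> V"
  shows "total_deg f = (\<Sum>u\<in>V. deg_in u f)"
  unfolding total_deg_def using assms
  by (intro sum.mono_neutral_left) (auto simp: in_vars_iff)

lemma total_deg_mult:
  assumes "f \<noteq> 0" "g \<noteq> (0 :: ('d, 'y, 'k::field) dpoly)"
  shows "total_deg (f * g) = total_deg f + total_deg g"
proof -
  let ?V = "vars f \<union> vars g"
  have "total_deg f = (\<Sum>u\<in>?V. deg_in u f)" "total_deg g = (\<Sum>u\<in>?V. deg_in u g)"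
    "total_deg (f * g) = (\<Sum>u\<in>?V. deg_in u (f * g))"
    using vars_mult_eq[OF assms] by (intro total_deg_eq; simp)+
  then show ?thesis using assms by (simp add: deg_in_mult sum.distrib)
qed

lemma total_deg_pos_iff: "total_deg f > 0 \<longleftrightarrow> f \<notin> constants"
proof -
  have "total_deg f = 0 \<longleftrightarrow> vars f = {}"
    by (auto simp: total_deg_def in_vars_iff)
  then show ?thesis by (metis neq0_conv vars_eq_empty_iff)
qed

lemma exists_irreducible_dvd:
  assumes "f \<notin> constants"
  shows "\<exists>p. irreducible p \<and> p dvd (f :: ('d, 'y, 'k::field) dpoly)"
  using assms
proof (induction "total_deg f" arbitrary: f rule: less_induct)
  case less
  have f0: "f \<noteq> 0" using less.prems vars_eq_empty_iff[of f] by auto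
  show ?case
  proof (cases "irreducible f")
    case False
    then obtain a b where ab: "f = a * b" "\<not> a dvd 1" "\<not> b dvd 1"
      using less.prems f0 by (auto simp: irreducible_def unit_iff_constant)
    with f0 have nz: "a \<noteq> 0" "b \<noteq> 0" by auto
    with ab have "a \<notin> constants" "b \<notin> constants" by (auto simp: unit_iff_constant)
    then have "total_deg a < total_deg f"
      using total_deg_mult[OF nz] ab(1) total_deg_pos_iff[of b] by simp
    from less.hyps[OF this \<open>a \<notin> constants\<close>] ab(1) show ?thesis by (metis dvd_mult2)
  qed auto
qed

lemma polys_in_0 [simp]: "0 \<in> polys_in V"
  by (simp add: polys_in_def)

lemma polys_in_add: "f \<in> polys_in V \<Longrightarrow> g \<in> polys_in V \<Longrightarrow> f + g \<in> polys_in V"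
  unfolding polys_in_def using vars_add[of f g] by blast

lemma polys_in_diff:
  "f \<in> polys_in V \<Longrightarrow> g \<in> polys_in V \<Longrightarrow> f - g \<in> polys_in V"
  for f g :: "('d, 'y, 'k::comm_ring_1) dpoly"
  unfolding polys_in_def using vars_diff[of f g] by blast

lemma polys_in_mult:
  "f \<in> polys_in V \<Longrightarrow> g \<in> polys_in V \<Longrightarrow> f * g \<in> polys_in V"
  for f g :: "('d, 'y, 'k::comm_ring_1) dpoly"
  unfolding polys_in_def using vars_mult[of f g] by blast

lemma polys_in_dvd:
  "f dvd g \<Longrightarrow> g \<noteq> 0 \<Longrightarrow> g \<in> polys_in V \<Longrightarrow> f \<in> polys_in V"
  for f g :: "('d, 'y, 'k::field) dpoly"
  unfolding polys_in_def using vars_dvd_subset[of f g] by blast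

lemma polys_in_mono: "V \<subseteq> W \<Longrightarrow> polys_in V \<subseteq> polys_in W"
  by (auto simp: polys_in_def)

lemma lead_coeff_in_polys_in:
  "f \<in> polys_in (insert x V) \<Longrightarrow> coeff_in x i f \<in> polys_in V"
  unfolding polys_in_def using vars_coeff_in[of x i f] by blast

section \<open>Primality of irreducible polynomials\<close>

lemma irreducible_not_const: "irreducible p \<Longrightarrow> p \<notin> constants"
  for p :: "('d, 'y, 'k::field) dpoly"
  by (auto simp: irreducible_def unit_iff_constant)

text \<open>Relative to \<open>k[V]\<close> to permit induction on \<open>V\<close>. Divisibility is
  that of the whole ring, which makes no difference: factors of a nonzero element of
  \<open>k[V]\<close> lie in \<open>k[V]\<close>.\<close>

definition prime_on :: "('d, 'y) dvar set \<Rightarrow> ('d, 'y, 'k::comm_ring_1) dpoly \<Rightarrow> bool" where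
  "prime_on V p \<longleftrightarrow> (\<forall>f\<in>polys_in V. \<forall>g\<in>polys_in V. p dvd f * g \<longrightarrow> p dvd f \<or> p dvd g)"

definition drop_lead :: "('d, 'y) dvar \<Rightarrow> ('d, 'y, 'k::comm_ring_1) dpoly \<Rightarrow> ('d, 'y, 'k) dpoly" where
  "drop_lead x f = f - coeff_in x (deg_in x f) f *
     Poly_Mapping.single (Poly_Mapping.single x (deg_in x f)) 1"

text \<open>Cancelling the top coefficient cannot lower a degree that is already 0, hence the first
  alternative.\<close>

lemma deg_in_less_cancel:
  fixes f g :: "('d, 'y, 'k::comm_ring_1) dpoly"
  assumes "deg_in x f \<le> n" "deg_in x g \<le> n" "coeff_in x n f = coeff_in x n g"
  shows "f - g \<in> polys_in (- {x}) \<and> n = 0 \<or> deg_in x (f - g) < n"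
proof (cases "n = 0")
  case True
  then show ?thesis
    using assms deg_in_diff_le[of x f g] by (auto simp: polys_in_def in_vars_iff)
next
  case False
  have "coeff_in x i (f - g) = 0" if "i \<ge> n" for i
    using that assms by (cases "i = n") (auto simp: coeff_in_diff coeff_in_above_deg)
  with False show ?thesis by (simp add: deg_in_less_iff_coeff)
qed

lemma drop_lead_deg:
  "deg_in x f > 0 \<Longrightarrow> deg_in x (drop_lead x f) < deg_in x f"
  "deg_in x f = 0 \<Longrightarrow> drop_lead x f = 0"
proof -
  have nx: "x \<notin> vars (coeff_in x (deg_in x f) f)" using vars_coeff_in[of x _ f] by blast
  show "deg_in x (drop_lead x f) < deg_in x f" if "deg_in x f > 0"
    unfolding deg_in_less_iff_coeff[OF that]
    by (auto simp: drop_lead_def coeff_in_diff coeff_in_times_power[OF nx] coeff_in_above_deg)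
  show "drop_lead x f = 0" if "deg_in x f = 0"
    using that coeff_in_free[of x f 0] by (simp add: drop_lead_def not_in_vars_iff)
qed

lemma dvd_coeff_in:
  assumes "x \<notin> vars p" "p dvd f"
  shows "p dvd coeff_in x i (f :: ('d, 'y, 'k::comm_ring_1) dpoly)"
  using assms by (auto simp: dvd_def coeff_in_mult_free)

lemma power_in_polys_in: "Poly_Mapping.single (Poly_Mapping.single x n) c \<in> polys_in (insert x V)"
  unfolding polys_in_def using vars_single_power[of x n c] by blast

lemma polys_in_drop_lead:
  assumes "f \<in> polys_in (insert x V)"
  shows "drop_lead x f \<in> polys_in (insert x V)"
  unfolding drop_lead_def
proof (intro polys_in_diff polys_in_mult assms)
  show "coeff_in x (deg_in x f) f \<in> polys_in (insert x V)"
    using lead_coeff_in_polys_in[OF assms] polys_in_mono[of V "insert x V"] by blast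
  show "Poly_Mapping.single (Poly_Mapping.single x (deg_in x f)) 1 \<in> polys_in (insert x V)"
    by (rule power_in_polys_in)
qed

text \<open>Gauss's lemma: remove leading terms that are divisible by \<open>p\<close>, one at a time.\<close>

lemma dvd_of_unit_mult: "u dvd 1 \<Longrightarrow> u * a dvd (a :: 'a::comm_semiring_1)"
  using mult_dvd_mono[of u 1 a a] by simp

lemma prime_on_insert:
  fixes p :: "('d, 'y, 'k::field) dpoly"
  assumes p: "p \<in> polys_in V" and x: "x \<notin> V" and prime: "prime_on V p"
  shows "prime_on (insert x V) p"
proof -
  have px: "x \<notin> vars p" using p x by (auto simp: polys_in_def)
  have "p dvd f \<or> p dvd g"
    if "f \<in> polys_in (insert x V)" "g \<in> polys_in (insert x V)" "p dvd f * g" for f g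
    using that
  proof (induction "deg_in x f + deg_in x g" arbitrary: f g rule: less_induct)
    case less
    \<comment> \<open>Stated for arbitrary \<open>a\<close>, \<open>b\<close> with the same degree
      sum, so that it serves for \<open>f, g\<close> as well as for \<open>g, f\<close>. A factor of
      degree 0 in \<open>x\<close> is its own leading coefficient; otherwise dropping the leading
      term keeps \<open>p dvd a * b\<close> and lowers the degree sum.\<close>
    have descent: "p dvd a \<or> p dvd b"
      if a: "a \<in> polys_in (insert x V)" "b \<in> polys_in (insert x V)" "p dvd a * b"
        and deg: "deg_in x a + deg_in x b = deg_in x f + deg_in x g"
        and lead: "p dvd coeff_in x (deg_in x a) a" for a b
    proof (cases "deg_in x a = 0")
      case True
      then show ?thesis using lead by (simp add: coeff_in_free not_in_vars_iff)
    next
      case False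
      have "drop_lead x a * b = a * b - coeff_in x (deg_in x a) a *
          (Poly_Mapping.single (Poly_Mapping.single x (deg_in x a)) 1 * b)"
        by (simp add: drop_lead_def algebra_simps)
      with a(3) lead have "p dvd drop_lead x a * b" by (metis dvd_diff dvd_mult2)
      with less.hyps[of "drop_lead x a" b] a polys_in_drop_lead drop_lead_deg(1) False deg
      have "p dvd drop_lead x a \<or> p dvd b" by (metis add_less_cancel_right gr0I)
      moreover have "a = drop_lead x a + coeff_in x (deg_in x a) a *
          Poly_Mapping.single (Poly_Mapping.single x (deg_in x a)) 1"
        by (simp add: drop_lead_def)
      ultimately show ?thesis using lead by (metis dvd_add dvd_mult2)
    qed
    have "p dvd coeff_in x (deg_in x f) f * coeff_in x (deg_in x g) g"
      using dvd_coeff_in[OF px less.prems(3), of "deg_in x f + deg_in x g"]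
      by (simp add: coeff_in_mult_top)
    then have "p dvd coeff_in x (deg_in x f) f \<or> p dvd coeff_in x (deg_in x g) g"
      using prime less.prems(1,2) lead_coeff_in_polys_in by (metis prime_on_def)
    then show ?case
    proof
      assume "p dvd coeff_in x (deg_in x f) f"
      then show ?thesis using less.prems by (intro descent) auto
    next
      assume "p dvd coeff_in x (deg_in x g) g"
      then show ?thesis
        using descent[of g f] less.prems by (auto simp: mult.commute add.commute)
    qed
  qed
  then show ?thesis by (auto simp: prime_on_def)
qed

text \<open>Takes the place of contents and primitive parts. Each irreducible factor of
  \<open>c\<close> is prime on \<open>W\<close>, so it divides \<open>q\<close> or \<open>h\<close>
  and can be cancelled there; what is cancelled accumulates in \<open>e1\<close> and
  \<open>e2\<close>, and the remaining parts multiply to \<open>s\<close>.\<close>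

lemma split_coefficient:
  fixes c :: "('d, 'y, 'k::field) dpoly"
  assumes primes: "\<And>p :: ('d, 'y, 'k) dpoly. irreducible p \<Longrightarrow> p \<in> polys_in V \<Longrightarrow> prime_on W p"
    and "c \<in> polys_in V" "c \<noteq> 0" "q \<in> polys_in W" "h \<in> polys_in W" "q \<noteq> 0" "h \<noteq> 0"
    and "c * s = q * h"
  shows "\<exists>q1 h1 e1 e2. s = q1 * h1 \<and> q = e1 * q1 \<and> h = e2 * h1 \<and> e1 \<in> polys_in V \<and> e2 \<in> polys_in V"
  using assms(2-)
proof (induction "total_deg c" arbitrary: c q h rule: less_induct)
  case less
  show ?case
  proof (cases "c \<in> constants")
    case True
    then obtain a where a: "c = Const a" "a \<noteq> 0" using less.prems by (auto simp: constants_def)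
    have inv: "Const (inverse a) * c = 1" "c * Const (inverse a) = 1"
      using a by (simp_all flip: Const_mult)
    have "s = Const (inverse a) * (c * s)" by (simp only: inv mult_1 flip: mult.assoc)
    then have "s = (Const (inverse a) * q) * h" by (simp only: less.prems(7) mult.assoc)
    moreover have "q = c * (Const (inverse a) * q)" by (simp only: inv mult_1 flip: mult.assoc)
    moreover have "h = 1 * h" by simp
    moreover have "(1 :: ('d, 'y, 'k) dpoly) \<in> polys_in V" by (simp add: polys_in_def)
    ultimately show ?thesis using less.prems(1) by blast
  next
    case False
    then obtain p c' where p: "irreducible p" "c = p * c'"
      using exists_irreducible_dvd by (metis dvdE)
    have nz: "p \<noteq> 0" "c' \<noteq> 0" using p(2) less.prems(2) by auto
    have pV: "p \<in> polys_in V" and cV: "c' \<in> polys_in V"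
      using polys_in_dvd[of p c V] polys_in_dvd[of c' c V] less.prems(1,2) p(2) by auto
    have small: "total_deg c' < total_deg c"
      using total_deg_mult[OF nz] total_deg_pos_iff[of p] irreducible_not_const[OF p(1)] p(2) by simp
    have "p dvd q * h" using less.prems(7) p(2) by (metis dvd_triv_left mult.assoc)
    then have "p dvd q \<or> p dvd h"
      using primes[OF p(1) pV] less.prems by (auto simp: prime_on_def)
    then show ?thesis
    proof
      assume "p dvd q"
      then obtain q' where q': "q = p * q'" by (rule dvdE)
      with less.prems(5) have q'0: "q' \<noteq> 0" by auto
      have "q' \<in> polys_in W" 
        by (rule polys_in_dvd[OF _ less.prems(5,3)]) (simp only: q' dvd_triv_right)
      moreover have "c' * s = q' * h"
        by (rule mpoly_mult_left_cancel[OF nz(1)])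
          (use less.prems(7) p(2) q' in \<open>simp add: mult.assoc\<close>)
      ultimately obtain q1 h1 e1 e2 where "s = q1 * h1" "q' = e1 * q1" "h = e2 * h1"
        "e1 \<in> polys_in V" "e2 \<in> polys_in V"
        using less.hyps[OF small cV nz(2), of q' h] less.prems(4,6) q'0 by blast
      moreover from this have "q = (p * e1) * q1" "p * e1 \<in> polys_in V"
        using q' pV by (simp_all add: polys_in_mult mult.assoc)
      ultimately show ?thesis by blast
    next
      assume "p dvd h"
      then obtain h' where h': "h = p * h'" by (rule dvdE)
      with less.prems(6) have h'0: "h' \<noteq> 0" by auto
      have "h' \<in> polys_in W" 
        by (rule polys_in_dvd[OF _ less.prems(6,4)]) (simp only: h' dvd_triv_right)
      moreover have "c' * s = q * h'"
        by (rule mpoly_mult_left_cancel[OF nz(1)])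
          (use less.prems(7) p(2) h' in \<open>simp add: ac_simps\<close>)
      ultimately obtain q1 h1 e1 e2 where "s = q1 * h1" "q = e1 * q1" "h' = e2 * h1"
        "e1 \<in> polys_in V" "e2 \<in> polys_in V"
        using less.hyps[OF small cV nz(2), of q h'] less.prems(3,5) h'0 by blast
      moreover from this have "h = (p * e2) * h1" "p * e2 \<in> polys_in V"
        using h' pV by (simp_all add: polys_in_mult mult.assoc)
      ultimately show ?thesis by blast
    qed
  qed
qed

text \<open>By minimality of the degree of \<open>h\<close>, every nonzero element of
  \<open>J\<close> admits a further pseudo-division step by \<open>h\<close>, and the result stays
  in \<open>J\<close>. So the process can only end with remainder 0.\<close>

lemma pseudo_divisible:
  fixes h :: "('d, 'y, 'k::field) dpoly"
  assumes h: "h \<in> J" "h \<noteq> 0"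
    and diff: "\<And>a b. a \<in> J \<Longrightarrow> b \<in> J \<Longrightarrow> a - b \<in> J"
    and mult: "\<And>a b. a \<in> J \<Longrightarrow> b \<in> polys_in (insert x V) \<Longrightarrow> b * a \<in> J"
    and sub: "J \<subseteq> polys_in (insert x V)"
    and least: "\<And>a. a \<in> J \<Longrightarrow> a \<noteq> 0 \<Longrightarrow> deg_in x h \<le> deg_in x a"
    and "t \<in> J"
  shows "\<exists>n q. coeff_in x (deg_in x h) h ^ n * t = q * h"
  using \<open>t \<in> J\<close>
proof (induction "deg_in x t" arbitrary: t rule: less_induct)
  case less
  let ?c = "coeff_in x (deg_in x h) h"
  show ?case
  proof (cases "t = 0")
    case True
    then have "?c ^ 0 * t = 0 * h" by simp
    then show ?thesis by blast
  next
    case False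
    let ?d = "deg_in x t - deg_in x h" and ?a = "coeff_in x (deg_in x t) t"
    let ?X = "Poly_Mapping.single (Poly_Mapping.single x ?d) 1 :: ('d, 'y, 'k) dpoly"
    have deg: "deg_in x h + ?d = deg_in x t" using least[OF less.prems False] by simp
    have free: "x \<notin> vars ?a" "x \<notin> vars ?c"
      using vars_coeff_in[of x _ t] vars_coeff_in[of x _ h] by blast+
    have inV: "?a \<in> polys_in (insert x V)" "?c \<in> polys_in (insert x V)"
      using lead_coeff_in_polys_in polys_in_mono[of V "insert x V"] less.prems h(1) sub by blast+
    have "?X \<in> polys_in (insert x V)" by (rule power_in_polys_in)
    then have J: "?c * t - (?a * ?X) * h \<in> J"
      using inV less.prems h(1) by (intro diff mult polys_in_mult)
    have degaX: "deg_in x (?a * ?X) \<le> ?d"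
      by (simp add: deg_in_le_iff_coeff coeff_in_times_power[OF free(1)])
    have c: "coeff_in x (deg_in x t) (?c * t) = coeff_in x (deg_in x t) ((?a * ?X) * h)"
    proof -
      have "coeff_in x (?d + deg_in x h) ((?a * ?X) * h) = ?a * ?c"
        using coeff_in_mult_top[OF degaX, of h "deg_in x h"] by (simp add: coeff_in_times_power[OF free(1)])
      then show ?thesis
        using coeff_in_mult_free[OF free(2), of "deg_in x t" t] deg
        by (simp only: add.commute mult.commute)
    qed
    have le: "deg_in x (?c * t) \<le> deg_in x t" "deg_in x ((?a * ?X) * h) \<le> deg_in x t"
      using deg_in_mult_le[of x ?c t] deg_in_mult_le[of x "?a * ?X" h] degaX deg free(2)
      by (simp_all add: not_in_vars_iff)
    have "\<exists>n q. ?c ^ n * (?c * t - (?a * ?X) * h) = q * h"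
    proof (cases "?c * t - (?a * ?X) * h = 0")
      case True
      then have "?c ^ 0 * (?c * t - (?a * ?X) * h) = 0 * h" by simp
      then show ?thesis by blast
    next
      case nz: False
      from deg_in_less_cancel[OF le c] show ?thesis
      proof
        \<comment> \<open>Degree 0 cannot drop, but then \<open>h\<close> is free of
          \<open>x\<close> as well and equals its own leading coefficient: one more factor
          \<open>?c\<close> already is a factor \<open>h\<close>.\<close>
        assume *: "?c * t - (?a * ?X) * h \<in> polys_in (- {x}) \<and> deg_in x t = 0"
        then have "deg_in x h = 0" using deg by simp
        then have "?c = h" using coeff_in_free[of x h 0] by (simp add: not_in_vars_iff)
        then have "?c ^ 1 * (?c * t - (?a * ?X) * h) = (?c * t - (?a * ?X) * h) * h"
          by (simp add: mult.commute)
        then show ?thesis by blast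
      next
        assume "deg_in x (?c * t - (?a * ?X) * h) < deg_in x t"
        then show ?thesis using less.hyps J by blast
      qed
    qed
    then obtain n q where "?c ^ n * (?c * t - (?a * ?X) * h) = q * h" by blast
    then have "?c ^ Suc n * t = (q + ?c ^ n * (?a * ?X)) * h"
      by (simp add: algebra_simps)
    then show ?thesis by blast
  qed
qed

lemma polys_in_power: "f \<in> polys_in V \<Longrightarrow> f ^ n \<in> polys_in V"
  for f :: "('d, 'y, 'k::comm_ring_1) dpoly"
proof (induction n)
  case 0
  then show ?case by (simp add: polys_in_def)
qed (simp add: polys_in_mult)

lemma mpoly_power_nonzero: "f \<noteq> 0 \<Longrightarrow> f ^ n \<noteq> 0" for f :: "('d, 'y, 'k::field) dpoly"
  by (induction n) (simp_all add: mpoly_mult_nonzero)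

text \<open>
  If \<open>p\<close> involves \<open>x\<close>, let \<open>h \<noteq> 0\<close> have minimal degree in the ideal \<open>(p, f)\<close>.  By pseudo-division \<open>h\<close>
  divides \<open>p\<close> and \<open>f\<close> up to factors free of \<open>x\<close>, which can be split off by the induction hypothesis.
  So either \<open>p\<close> is associated to the part of \<open>h\<close> that divides it, and then divides \<open>f\<close>, or \<open>h\<close> is
  itself free of \<open>x\<close>, and \<open>p\<close> divides \<open>h * g\<close>, hence \<open>g\<close>.
\<close>

lemma irreducible_prime_on:
  fixes p :: "('d, 'y, 'k::field) dpoly"
  assumes "finite V" "irreducible p" "p \<in> polys_in V"
  shows "prime_on V p"
  using assms
proof (induction V arbitrary: p)
  case empty
  then show ?case using irreducible_not_const[of p] vars_eq_empty_iff[of p] by (auto simp: polys_in_def)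
next
  case (insert x V)
  let ?S = "polys_in (insert x V) :: ('d, 'y, 'k) dpoly set"
  have VS: "polys_in V \<subseteq> ?S" by (rule polys_in_mono) auto
  have primes: "prime_on (insert x V) q" if "irreducible q" "q \<in> polys_in V" for q :: "('d, 'y, 'k) dpoly"
    using that insert by (intro prime_on_insert) auto
  show ?case
  proof (cases "p \<in> polys_in V")
    case True
    with primes insert.prems show ?thesis by blast
  next
    case pV: False
    have p0: "p \<noteq> 0" using insert.prems by auto
    \<comment> \<open>Splitting \<open>e\<close> off gives \<open>p = e1 * q1\<close> with
      \<open>e1\<close> in \<open>k[V]\<close> and \<open>q1 dvd t\<close>. A unit \<open>q1\<close>
      would put \<open>p\<close> into \<open>k[V]\<close>, so \<open>e1\<close> is the unit and
      \<open>p\<close> divides \<open>q1\<close>.\<close>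
    have cancel: "p dvd t"
      if et: "p dvd e * t" "e \<in> polys_in V" "e \<noteq> 0" "t \<in> ?S" "t \<noteq> 0" for e t
    proof -
      obtain r where r: "e * t = p * r" using et(1) by (rule dvdE)
      then have "p * r \<noteq> 0" "p * r \<in> ?S"
        using mpoly_mult_nonzero[OF et(3,5)] polys_in_mult[of e _ t] et VS by (metis, metis subsetD)
      then have "r \<noteq> 0" "r \<in> ?S" using polys_in_dvd[of r "p * r"] by auto
      then obtain q1 h1 e1 e2 where *: "t = q1 * h1" "p = e1 * q1" "r = e2 * h1" "e1 \<in> polys_in V"
        using split_coefficient[OF primes et(2,3) insert.prems(2) _ p0 _ r] by blast
      have "e1 dvd 1 \<or> q1 dvd 1" using insert.prems(1) *(2) by (auto simp: irreducible_def)
      then have "e1 dvd 1"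
      proof
        assume "q1 dvd 1"
        then have "q1 \<in> polys_in V"
          by (auto simp: unit_iff_constant polys_in_def simp flip: vars_eq_empty_iff)
        with * pV polys_in_mult show ?thesis by blast
      qed
      then have "p dvd q1" using dvd_of_unit_mult *(2) by simp
      then show ?thesis using *(1) by simp
    qed
    have "p dvd f \<or> p dvd g" if fg: "f \<in> ?S" "g \<in> ?S" "p dvd f * g" for f g
    proof (cases "f = 0 \<or> g = 0")
      case False
      define J where "J = {a * p + b * f | a b. a \<in> ?S \<and> b \<in> ?S}"
      have one: "1 \<in> ?S" by (simp add: polys_in_def)
      have "1 * p + 0 * f \<in> J" "0 * p + 1 * f \<in> J"
        unfolding J_def using one polys_in_0 by blast+
      then have pJ: "p \<in> J" and fJ: "f \<in> J" by simp_all
      have sub: "J \<subseteq> ?S"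
        unfolding J_def using fg(1) insert.prems(2) by (auto intro!: polys_in_add polys_in_mult)
      have diff: "a - b \<in> J" if ab: "a \<in> J" "b \<in> J" for a b
      proof -
        obtain a1 a2 b1 b2 where "a = a1 * p + a2 * f" "b = b1 * p + b2 * f"
          "a1 \<in> ?S" "a2 \<in> ?S" "b1 \<in> ?S" "b2 \<in> ?S"
          using ab unfolding J_def by blast
        moreover from this have "a - b = (a1 - b1) * p + (a2 - b2) * f" by (simp add: algebra_simps)
        ultimately show ?thesis unfolding J_def using polys_in_diff by blast
      qed
      have mult: "b * a \<in> J" if ab: "a \<in> J" "b \<in> ?S" for a b
      proof -
        obtain a1 a2 where "a = a1 * p + a2 * f" "a1 \<in> ?S" "a2 \<in> ?S"
          using ab unfolding J_def by blast
        moreover from this have "b * a = (b * a1) * p + (b * a2) * f" by (simp add: algebra_simps)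
        ultimately show ?thesis unfolding J_def using polys_in_mult ab by blast
      qed
      obtain h where h: "h \<in> J" "h \<noteq> 0" and least: "\<And>a. a \<in> J \<Longrightarrow> a \<noteq> 0 \<Longrightarrow> deg_in x h \<le> deg_in x a"
        using pJ p0 ex_has_least_nat[of "\<lambda>h. h \<in> J \<and> h \<noteq> 0" p "deg_in x"] by blast
      let ?c = "coeff_in x (deg_in x h) h"
      have hS: "h \<in> ?S" using h sub by blast
      have c: "?c ^ n \<in> polys_in V" "?c ^ n \<noteq> 0" for n
        by (rule polys_in_power[OF lead_coeff_in_polys_in[OF hS]],
            rule mpoly_power_nonzero[OF lead_coeff_in_nonzero[OF h(2)]])
      have pd: "\<exists>n q. ?c ^ n * t = q * h" if "t \<in> J" for t
        by (rule pseudo_divisible[of h J x V]) (use h diff mult sub least that in blast)+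
      obtain n q where q: "?c ^ n * p = q * h" using pd[OF pJ] by blast
      obtain n' q' where q': "?c ^ n' * f = q' * h" using pd[OF fJ] by blast
      have "q * h \<noteq> 0" "q * h \<in> ?S"
        using mpoly_mult_nonzero[OF c(2) p0] polys_in_mult[of "?c ^ n" _ p] c(1) VS insert.prems(2) q
        by (metis, metis subsetD)
      then have "q \<noteq> 0" "q \<in> ?S" using polys_in_dvd[of q "q * h"] by auto
      then obtain q1 h1 e1 e2 where *: "p = q1 * h1" "h = e2 * h1" "e2 \<in> polys_in V"
        using split_coefficient[OF primes c _ hS _ h(2) q] by blast
      have "q1 dvd 1 \<or> h1 dvd 1" using insert.prems(1) *(1) by (auto simp: irreducible_def)
      then show ?thesis
      proof
        assume "q1 dvd 1"
        then have "p dvd h1" using dvd_of_unit_mult *(1) by simp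
        then have "p dvd ?c ^ n' * f" using *(2) q' by simp
        then show ?thesis using cancel[OF _ c] fg(1) False by blast
      next
        assume "h1 dvd 1"
        then have "h1 \<in> polys_in V"
          by (auto simp: unit_iff_constant polys_in_def simp flip: vars_eq_empty_iff)
        then have hV: "h \<in> polys_in V" using * polys_in_mult by blast
        obtain a b where "h = a * p + b * f" using h(1) unfolding J_def by blast
        then have "h * g = a * g * p + b * (f * g)" by (simp add: algebra_simps)
        then have "p dvd h * g" using fg(3) by simp
        then show ?thesis using cancel[OF _ hV h(2)] fg(2) False by blast
      qed
    qed auto
    then show ?thesis by (auto simp: prime_on_def)
  qed
qed

lemma irreducible_dvd_mult:
  fixes p :: "('d, 'y, 'k::field) dpoly"
  assumes "irreducible p" "p dvd f * g"
  shows "p dvd f \<or> p dvd g"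
  using irreducible_prime_on[of "vars p \<union> vars f \<union> vars g" p] assms
  by (auto simp: prime_on_def polys_in_def)

text \<open>An irreducible factor of \<open>a\<close> divides \<open>b * g\<close> but not
  \<open>g\<close>, hence divides \<open>b\<close> and can be cancelled from \<open>a\<close> and
  \<open>b\<close>.\<close>

lemma dvd_of_no_common_factor:
  fixes a :: "('d, 'y, 'k::field) dpoly"
  assumes "a dvd b * g" "a \<noteq> 0" "b \<noteq> 0"
    and "\<And>p. p dvd a \<Longrightarrow> p dvd g \<Longrightarrow> p \<in> constants"
  shows "a dvd b"
  using assms
proof (induction "total_deg a" arbitrary: a b rule: less_induct)
  case less
  show ?case
  proof (cases "a \<in> constants")
    case True
    then have "a dvd 1" using less.prems(2) by (simp add: unit_iff_constant)
    then show ?thesis by (metis dvd_trans one_dvd)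
  next
    case False
    then obtain p a' where p: "irreducible p" "a = p * a'"
      using exists_irreducible_dvd by (metis dvdE)
    have nz: "p \<noteq> 0" "a' \<noteq> 0" using p(2) less.prems(2) by auto
    have "\<not> p dvd g" using less.prems(4)[of p] irreducible_not_const p by auto
    moreover have "p dvd b * g" using less.prems(1) p(2) by (metis dvd_mult_left)
    ultimately have "p dvd b" using irreducible_dvd_mult[OF p(1)] by blast
    then obtain b' where b': "b = p * b'" by (rule dvdE)
    obtain r where "b * g = a * r" using less.prems(1) by (rule dvdE)
    then have "p * (b' * g) = p * (a' * r)" using b' p(2) by (simp add: mult.assoc)
    then have "a' dvd b' * g" using mpoly_mult_left_cancel[OF nz(1)] by (metis dvd_triv_left)
    moreover have "total_deg a' < total_deg a"
      using total_deg_mult[OF nz] total_deg_pos_iff[of p] irreducible_not_const[OF p(1)] p(2) by simp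
    moreover have "b' \<noteq> 0" using b' less.prems(3) by auto
    moreover have "q \<in> constants" if "q dvd a'" "q dvd g" for q
      using that less.prems(4) p(2) by simp
    ultimately have "a' dvd b'" using less.hyps nz(2) by blast
    then show ?thesis using b' p(2) by (simp add: mult_dvd_mono)
  qed
qed

declare split_paired_All [simp del] split_paired_Ex [simp del]

section \<open>Finiteness of autoreduced sets\<close>

text \<open>Some subsequence is monotone; if it decreases, it is constant from the place of its
  least value on, and the tail will do.\<close>

lemma nat_incseq_subseq: "\<exists>r. strict_mono r \<and> incseq (\<lambda>n. c (r n))" for c :: "nat \<Rightarrow> nat"
proof -
  obtain r where r: "strict_mono r" "monoseq (\<lambda>n. c (r n))"
    using seq_monosub[of c] by blast
  then consider "incseq (\<lambda>n. c (r n))" | "decseq (\<lambda>n. c (r n))" by (auto simp: monoseq_iff)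
  then show ?thesis
  proof cases
    case 2
    obtain N where N: "\<And>n. c (r N) \<le> c (r n)"
      using ex_has_least_nat[of "\<lambda>_. True" 0 "\<lambda>n. c (r n)"] by auto
    then have const: "c (r (n + N)) = c (r N)" for n
      using 2 by (intro antisym) (auto simp: decseq_def)
    have "strict_mono (\<lambda>n. r (n + N))" using r(1) by (simp add: strict_mono_def)
    then show ?thesis using const by (intro exI[of _ "\<lambda>n. r (n + N)"]) (simp add: incseq_def)
  qed (use r in blast)
qed

text \<open>Dickson's lemma for sequences: thin out one coordinate at a time, since passing to a
  further subsequence preserves the monotonicity already reached.\<close>

lemma dickson_subseq:
  assumes "finite K"
  shows "\<exists>r. strict_mono r \<and> (\<forall>k\<in>K. incseq (\<lambda>n. (c :: 'a \<Rightarrow> nat \<Rightarrow> nat) k (r n)))"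
  using assms
proof (induction K)
  case empty
  show ?case by (auto intro: exI[of _ id] simp: strict_mono_def)
next
  case (insert k K)
  then obtain r where r: "strict_mono r" "\<forall>k\<in>K. incseq (\<lambda>n. c k (r n))" by blast
  obtain s where s: "strict_mono s" "incseq (\<lambda>n. c k (r (s n)))"
    using nat_incseq_subseq[of "\<lambda>n. c k (r n)"] by blast
  have "strict_mono (\<lambda>n. r (s n))" using r(1) s(1) by (simp add: strict_mono_def)
  moreover have "incseq (\<lambda>n. c j (r (s n)))" if "j \<in> K" for j
    using r(2) that s(1) unfolding incseq_def by (meson strict_mono_less_eq)
  ultimately show ?case using s(2) by (intro exI[of _ "\<lambda>n. r (s n)"]) auto
qed

text \<open>Infinitely many elements of \<open>S\<close> belong to one indeterminate, and by Dickson
  two of these have exponent vectors that are comparable in every coordinate; their difference is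
  the operator sought.\<close>

lemma infinite_proper_derivative:
  fixes S :: "('d::finite, 'y::finite) dvar set"
  assumes "infinite S"
  shows "\<exists>u\<in>S. \<exists>\<theta>. \<theta> \<noteq> 0 \<and> apply_op \<theta> u \<in> S"
proof -
  have "finite (snd ` S)" by (rule finite_subset[OF subset_UNIV]) simp
  then obtain u0 :: "('d, 'y) dvar" where inf: "infinite {u \<in> S. snd u = snd u0}"
    using pigeonhole_infinite[OF assms, of snd] by blast
  obtain f :: "nat \<Rightarrow> ('d, 'y) dvar" where f: "inj f" "range f \<subseteq> {u \<in> S. snd u = snd u0}"
    using infinite_countable_subset[OF inf] by blast
  obtain r where r: "strict_mono r" "\<And>k. incseq (\<lambda>n. Poly_Mapping.lookup (fst (f (r n))) k)"
    using dickson_subseq[of "UNIV :: 'd set" "\<lambda>k n. Poly_Mapping.lookup (fst (f n)) k"] by auto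
  define u v where "u = f (r 0)" and "v = f (r 1)"
  have "f n \<in> S \<and> snd (f n) = snd u0" for n using f(2) by blast
  then have S: "u \<in> S" "v \<in> S" and snd: "snd v = snd u" by (auto simp: u_def v_def)
  have "r 0 \<noteq> r 1" using r(1) by (simp add: strict_mono_eq)
  then have "u \<noteq> v" using f(1) by (auto simp: u_def v_def inj_eq)
  have le: "Poly_Mapping.lookup (fst u) k \<le> Poly_Mapping.lookup (fst v) k" for k
    using incseqD[OF r(2), of 0 1] by (simp add: u_def v_def)
  have v: "apply_op (fst v - fst u) u = v"
    using le snd by (auto simp: apply_op_def prod_eq_iff lookup_add lookup_minus intro!: poly_mapping_eqI)
  have "fst v - fst u \<noteq> 0" using v \<open>u \<noteq> v\<close> by (auto simp: apply_op_def)
  then show ?thesis using v S by metis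
qed

section \<open>Rankings, leaders and autoreduced sets\<close>

lemma ranking_linorder: "ranking le \<Longrightarrow> class.linorder le (strict le)"
  by (simp add: ranking_def)

lemma ranking_refl: "ranking le \<Longrightarrow> le u u"
  and ranking_trans: "ranking le \<Longrightarrow> le u v \<Longrightarrow> le v w \<Longrightarrow> le u w"
  and ranking_antisym: "ranking le \<Longrightarrow> le u v \<Longrightarrow> le v u \<Longrightarrow> u = v"
  and ranking_total: "ranking le \<Longrightarrow> le u v \<or> le v u"
  using ranking_linorder[of le]
  unfolding class.linorder_def class.linorder_axioms_def class.order_def class.order_axioms_def
    class.preorder_def
  by blast+

lemma ranking_apply_op: "ranking le \<Longrightarrow> le u (apply_op \<theta> u)"
  by (simp add: ranking_def)

lemma apply_op_eq_iff [simp]: "apply_op \<theta> u = u \<longleftrightarrow> \<theta> = 0"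
  by (simp add: apply_op_def prod_eq_iff)

lemma proper_derivative_not_le:
  assumes "ranking le" "\<theta> \<noteq> 0"
  shows "\<not> le (apply_op \<theta> u) u"
  using assms ranking_antisym[OF assms(1) ranking_apply_op[OF assms(1)], of \<theta> u] apply_op_eq_iff
  by metis

lemma leader_props:
  assumes r: "ranking le" and "f \<notin> constants"
  shows "leader le f \<in> vars f" "\<And>v. v \<in> vars f \<Longrightarrow> le v (leader le f)"
proof -
  have "\<exists>u\<in>V. \<forall>v\<in>V. le v u" if "finite V" "V \<noteq> {}" for V
    using that
  proof (induction V rule: finite_ne_induct)
    case (singleton x)
    then show ?case using ranking_refl[OF r] by auto
  next
    case (insert x V)
    then obtain u where u: "u \<in> V" "\<forall>v\<in>V. le v u" by blast
    from ranking_total[OF r, of x u] show ?case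
    proof
      assume "le x u"
      then show ?thesis using u by blast
    next
      assume "le u x"
      then have "\<forall>v\<in>insert x V. le v x" using u(2) ranking_trans[OF r] ranking_refl[OF r] by blast
      then show ?thesis by blast
    qed
  qed
  from this[of "vars f"] have "\<exists>u. u \<in> vars f \<and> (\<forall>v\<in>vars f. le v u)"
    using assms(2) by (auto simp: vars_eq_empty_iff)
  then have "\<exists>!u. u \<in> vars f \<and> (\<forall>v\<in>vars f. le v u)"
    using ranking_antisym[OF r] by blast
  from theI'[OF this] show "leader le f \<in> vars f" "\<And>v. v \<in> vars f \<Longrightarrow> le v (leader le f)"
    unfolding leader_def by blast+
qed

lemma autoreducedD:
  assumes "autoreduced le A" "f \<in> A" "g \<in> A" "f \<noteq> g"
  shows "\<theta> \<noteq> 0 \<Longrightarrow> apply_op \<theta> (leader le g) \<notin> vars f"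
    "deg_in (leader le g) f < deg_in (leader le g) g"
  using assms unfolding autoreduced_def reduced_wrt_def by blast+

lemma autoreduced_not_const: "autoreduced le A \<Longrightarrow> f \<in> A \<Longrightarrow> f \<notin> constants"
  by (auto simp: autoreduced_def)

text \<open>Two distinct elements with a common leader would each have smaller degree in it than the
  other.\<close>

lemma autoreduced_leader_inj: "autoreduced le A \<Longrightarrow> inj_on (leader le) A"
  by (rule inj_onI) (metis autoreducedD(2) less_asym)

lemma autoreduced_finite:
  fixes A :: "('d::finite, 'y::finite, 'k::zero) dpoly set"
  assumes r: "ranking le" and A: "autoreduced le A"
  shows "finite A"
proof (rule ccontr)
  assume "infinite A"
  then have "infinite (leader le ` A)"
    using autoreduced_leader_inj[OF A] by (simp add: finite_image_iff)
  from infinite_proper_derivative[OF this] obtain f g \<theta> where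
    fg: "f \<in> A" "g \<in> A" "\<theta> \<noteq> 0" "apply_op \<theta> (leader le f) = leader le g" by blast
  then have "g \<noteq> f" by auto
  then show False
    using autoreducedD(1)[OF A fg(2,1) _ fg(3)] fg(4)
      leader_props(1)[OF r autoreduced_not_const[OF A fg(2)]] by simp
qed

section \<open>Characteristic sets\<close>

lemma rank_less_trans:
  assumes "ranking le" "rank_less le p q" "rank_less le q s"
  shows "rank_less le p s"
proof -
  have "strict le u w" if "strict le u v" "strict le v w" for u v w
    using that ranking_trans[OF assms(1)] unfolding strict_def by blast
  from this[of "fst p" "fst q" "fst s"] show ?thesis using assms(2,3) unfolding rank_less_def by auto
qed

lemma rank_less_irrefl: "\<not> rank_less le p p"
  by (simp add: rank_less_def strict_def)

lemma rank_less_total: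
  assumes "ranking le"
  shows "rank_less le p q \<or> p = q \<or> rank_less le q p"
  using ranking_total[OF assms, of "fst p" "fst q"] ranking_antisym[OF assms, of "fst p" "fst q"]
  unfolding rank_less_def strict_def by (auto simp: prod_eq_iff)

lemma rank_enum_exists:
  assumes r: "ranking le" and "finite A" and inj: "inj_on (rank le) A"
  shows "\<exists>as. rank_enum le A as"
  using assms(2,3)
proof (induction A)
  case empty
  then show ?case by (auto simp: rank_enum_def)
next
  case (insert f A)
  then obtain as where as: "set as = A" "sorted_wrt (\<lambda>f g. rank_less le (rank le f) (rank le g)) as"
    by (auto simp: rank_enum_def)
  let ?P = "\<lambda>g. rank_less le (rank le g) (rank le f)"
  let ?bs = "filter ?P as @ f # filter (\<lambda>g. \<not> ?P g) as"
  have gt: "rank_less le (rank le f) (rank le g)" if "g \<in> A" "\<not> ?P g" for g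
    using that rank_less_total[OF r] insert.prems insert.hyps(2) by (fastforce simp: inj_on_def)
  then have "sorted_wrt (\<lambda>f g. rank_less le (rank le f) (rank le g)) ?bs"
    using as by (auto simp: sorted_wrt_append sorted_wrt_filter intro: rank_less_trans[OF r])
  moreover have "set ?bs = insert f A" using as(1) by auto
  ultimately show ?case unfolding rank_enum_def by blast
qed

lemma autoreduced_rank_enum:
  fixes A :: "('d::finite, 'y::finite, 'k::zero) dpoly set"
  assumes r: "ranking le" and A: "autoreduced le A"
  shows "\<exists>as. rank_enum le A as"
proof (rule rank_enum_exists[OF r autoreduced_finite[OF assms]])
  show "inj_on (rank le) A"
    using autoreduced_leader_inj[OF A] by (auto simp: inj_on_def rank_def)
qed

text \<open>Otherwise \<open>f\<close>, preceded by the elements of \<open>A\<close> of lower rank, is of lower rank than \<open>A\<close>.\<close>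

lemma reduced_in_constants:
  fixes A :: "('d::finite, 'y::finite, 'k::zero) dpoly set"
  assumes r: "ranking le" and A: "characteristic_set le J A" and f: "f \<in> J"
    and red: "\<And>a. a \<in> A \<Longrightarrow> reduced_wrt le f a"
  shows "f \<in> constants"
proof (rule ccontr)
  assume fc: "f \<notin> constants"
  have auto: "autoreduced le A" and AJ: "A \<subseteq> J"
    and min: "\<And>B. autoreduced le B \<Longrightarrow> B \<subseteq> J \<Longrightarrow> \<not> lower_rank le B A"
    using A by (auto simp: characteristic_set_def)
  obtain as where as: "set as = A" "sorted_wrt (\<lambda>f g. rank_less le (rank le f) (rank le g)) as"
    using autoreduced_rank_enum[OF r auto] by (auto simp: rank_enum_def)
  let ?P = "\<lambda>a. rank_less le (rank le a) (rank le f)"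
  define B where "B = insert f {a \<in> A. ?P a}"
  have ne: "rank le a \<noteq> rank le f" if "a \<in> A" for a
    using red[OF that] by (auto simp: reduced_wrt_def rank_def)
  have red': "reduced_wrt le a f" if a: "a \<in> A" "?P a" for a
  proof -
    \<comment> \<open>With equal leaders, the lower rank of \<open>a\<close> would mean a smaller
      degree than that of \<open>f\<close>, whereas \<open>f\<close> is reduced with respect to
      \<open>a\<close>.\<close>
    have "leader le a \<noteq> leader le f"
      using red[OF a(1)] a(2) by (auto simp: reduced_wrt_def rank_less_def rank_def strict_def)
    then have less: "le (leader le a) (leader le f)" "\<not> le (leader le f) (leader le a)"
      using a(2) by (auto simp: rank_less_def rank_def strict_def)
    have "apply_op \<theta> (leader le f) \<notin> vars a" for \<theta>
      using leader_props(2)[OF r autoreduced_not_const[OF auto a(1)]] less(2)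
        ranking_trans[OF r ranking_apply_op[OF r]] by blast
    from this this[of 0] have "leader le f \<notin> vars a" by (simp add: apply_op_def)
    then show ?thesis
      using \<open>\<And>\<theta>. apply_op \<theta> (leader le f) \<notin> vars a\<close> leader_props(1)[OF r fc]
      by (simp add: reduced_wrt_def in_vars_iff)
  qed
  have "autoreduced le B"
    using auto red red' fc unfolding autoreduced_def B_def by blast
  moreover have "B \<subseteq> J" using AJ f by (auto simp: B_def)
  moreover have "lower_rank le B A"
  proof -
    \<comment> \<open>The elements of rank below that of \<open>f\<close> form an initial segment of
      the sorted list, and \<open>f\<close> takes the next place. Either it replaces an element of
      higher rank there, or it makes the list longer; both lower the rank.\<close>
    define bs where "bs = takeWhile ?P as"
    have len: "length bs \<le> length as" by (simp add: bs_def length_takeWhile_le)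
    have bs_nth: "bs ! i = as ! i" if "i < length bs" for i
      using that by (simp add: bs_def takeWhile_nth)
    have stop: "rank_less le (rank le f) (rank le (as ! length bs))" if "length bs < length as"
      using that nth_length_takeWhile[of ?P as] ne[of "as ! length bs"] rank_less_total[OF r] as(1)
      by (metis bs_def nth_mem)
    have "set bs = {a \<in> A. ?P a}"
    proof
      show "set bs \<subseteq> {a \<in> A. ?P a}" using as(1) by (auto simp: bs_def dest: set_takeWhileD)
      show "{a \<in> A. ?P a} \<subseteq> set bs"
      proof
        fix a assume a: "a \<in> {a \<in> A. ?P a}"
        then obtain i where i: "i < length as" "a = as ! i" using as(1) by (auto simp: in_set_conv_nth)
        have "i < length bs"
        proof (rule ccontr)
          assume "\<not> i < length bs"
          then have "rank_less le (rank le f) (rank le a)"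
            using stop i as(2) rank_less_trans[OF r]
            by (cases "i = length bs") (auto simp: sorted_wrt_iff_nth_less)
          then show False using a rank_less_trans[OF r] rank_less_irrefl by blast
        qed
        then show "a \<in> set bs" using i bs_nth by (metis nth_mem)
      qed
    qed
    then have "rank_enum le B (bs @ [f])"
      using as(2) sorted_wrt_takeWhile[of _ as ?P]
      by (auto simp: rank_enum_def B_def sorted_wrt_append bs_def dest: set_takeWhileD)
    moreover have "list_lower_rank le (bs @ [f]) as"
    proof (cases "length bs < length as")
      case True
      then show ?thesis
        using stop bs_nth by (auto simp: list_lower_rank_def nth_append intro!: exI[of _ "length bs"])
    next
      case False
      then have "length as = length bs" using len by simp
      then show ?thesis using bs_nth by (auto simp: list_lower_rank_def nth_append)
    qed
    moreover have "rank_enum le A as" using as by (simp add: rank_enum_def)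
    ultimately show ?thesis unfolding lower_rank_def by blast
  qed
  ultimately show False using min by blast
qed

text \<open>The first difference in rank decides, and without one the longer list is lower. Two
  characteristic sets are not lower than each other, which leaves only equal ranks.\<close>

lemma list_lower_rank_total:
  assumes r: "ranking le"
  shows "list_lower_rank le as bs \<or> list_lower_rank le bs as \<or> map (rank le) as = map (rank le) bs"
proof -
  let ?differ = "\<lambda>i. i < length as \<and> i < length bs \<and> rank le (as ! i) \<noteq> rank le (bs ! i)"
  show ?thesis
  proof (cases "\<exists>i. ?differ i")
    case True
    define j where "j = (LEAST i. ?differ i)"
    have j: "?differ j" unfolding j_def using True by (rule LeastI_ex)
    have "rank le (as ! i) = rank le (bs ! i)" if "i < j" for i
      using not_less_Least[of i ?differ] that j unfolding j_def[symmetric] by auto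
    then show ?thesis
      using j rank_less_total[OF r, of "rank le (as ! j)" "rank le (bs ! j)"]
      unfolding list_lower_rank_def by metis
  next
    case False
    then show ?thesis
      by (cases "length as" "length bs" rule: linorder_cases)
        (auto simp: list_lower_rank_def list_eq_iff_nth_eq)
  qed
qed

lemma characteristic_sets_same_ranks:
  fixes A B :: "('d::finite, 'y::finite, 'k::zero) dpoly set"
  assumes r: "ranking le" and "characteristic_set le J A" "characteristic_set le J B"
  shows "rank le ` A = rank le ` B"
proof -
  have A: "autoreduced le A" "A \<subseteq> J" and B: "autoreduced le B" "B \<subseteq> J"
    and min: "\<not> lower_rank le A B" "\<not> lower_rank le B A"
    using assms(2,3) unfolding characteristic_set_def by blast+
  obtain as where as: "rank_enum le A as" using autoreduced_rank_enum[OF r A(1)] ..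
  obtain bs where bs: "rank_enum le B bs" using autoreduced_rank_enum[OF r B(1)] ..
  have "\<not> list_lower_rank le as bs" "\<not> list_lower_rank le bs as"
    using min as bs unfolding lower_rank_def by blast+
  then have "map (rank le) as = map (rank le) bs" using list_lower_rank_total[OF r, of as bs] by blast
  then have "set (map (rank le) as) = set (map (rank le) bs)" by simp
  then show ?thesis using as bs by (simp add: rank_enum_def)
qed

section \<open>Characterizable ideals are proper\<close>

lemma derivation_add: "derivation D \<Longrightarrow> D (a + b) = D a + D b"
  and derivation_mult: "derivation D \<Longrightarrow> D (a * b) = D a * b + a * D b"
  by (simp_all add: derivation_def)

lemma derivation_0: "derivation D \<Longrightarrow> D 0 = (0 :: 'a::comm_ring_1)"
  using derivation_add[of D 0 0] by simp

lemma derivation_1: "derivation D \<Longrightarrow> D 1 = (0 :: 'a::comm_ring_1)"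
  using derivation_mult[of D 1 1] by simp

lemma derivation_power:
  "derivation D \<Longrightarrow> D (x ^ n) = of_nat n * x ^ (n - 1) * D (x :: 'a::comm_ring_1)"
proof (induction n)
  case 0
  then show ?case by (simp add: derivation_1)
next
  case (Suc n)
  then show ?case by (cases n) (simp_all add: derivation_mult algebra_simps)
qed

lemma derivation_prod:
  assumes "derivation D" "finite K"
  shows "D (\<Prod>u\<in>K. g u) = (\<Sum>u\<in>K. D (g u) * (\<Prod>v\<in>K - {u}. g v :: 'a::comm_ring_1))"
  using assms(2)
proof (induction K)
  case empty
  then show ?case by (simp add: derivation_1[OF assms(1)])
next
  case (insert x K)
  have "(\<Sum>u\<in>K. D (g u) * (\<Prod>v\<in>insert x K - {u}. g v)) =
      (\<Sum>u\<in>K. g x * (D (g u) * (\<Prod>v\<in>K - {u}. g v)))"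
  proof (rule sum.cong[OF refl])
    fix u assume "u \<in> K"
    then have "insert x K - {u} = insert x (K - {u})" using insert.hyps by auto
    then show "D (g u) * (\<Prod>v\<in>insert x K - {u}. g v) = g x * (D (g u) * (\<Prod>v\<in>K - {u}. g v))"
      using insert.hyps by (simp add: ac_simps)
  qed
  moreover have "insert x K - {x} = K" using insert.hyps by auto
  ultimately show ?case
    using insert by (simp add: derivation_mult[OF assms(1)] sum_distrib_left)
qed

text \<open>The action of \<open>\<Theta>\<close> on \<open>k\<close>; the order of the fold is
  immaterial once the derivations commute. It serves to prescribe values at all derivatives of an
  indeterminate from a value at the indeterminate.\<close>

definition op_action :: "('d \<Rightarrow> 'k \<Rightarrow> 'k) \<Rightarrow> 'd diff_op \<Rightarrow> 'k \<Rightarrow> 'k" where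
  "op_action \<delta> \<theta> a = Finite_Set.fold (\<lambda>i. \<delta> i ^^ Poly_Mapping.lookup \<theta> i) a UNIV"

lemma op_action_0: "op_action \<delta> 0 a = a" for \<delta> :: "'d::finite \<Rightarrow> 'k \<Rightarrow> 'k"
proof -
  interpret comp_fun_commute "\<lambda>(i :: 'd) (a :: 'k). a" by standard auto
  have "Finite_Set.fold (\<lambda>(i :: 'd) (a :: 'k). a) a A = a" if "finite A" for A
    using that by induction auto
  then show ?thesis by (simp add: op_action_def id_def[abs_def])
qed

lemma op_action_Suc:
  fixes \<delta> :: "'d::finite \<Rightarrow> 'k \<Rightarrow> 'k"
  assumes comm: "\<And>i j a. \<delta> i (\<delta> j a) = \<delta> j (\<delta> i a)"
  shows "op_action \<delta> (Poly_Mapping.single i 1 + \<theta>) a = \<delta> i (op_action \<delta> \<theta> a)"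
proof -
  have c1: "(\<delta> i ^^ m) (\<delta> j a) = \<delta> j ((\<delta> i ^^ m) a)" for i j m a
    by (induction m) (simp_all add: comm)
  have c2: "(\<delta> i ^^ m) ((\<delta> j ^^ n) a) = (\<delta> j ^^ n) ((\<delta> i ^^ m) a)" for i j m n a
    by (induction n) (simp_all add: c1)
  have cf: "comp_fun_commute (\<lambda>i. \<delta> i ^^ Poly_Mapping.lookup \<theta> i)" for \<theta>
    by standard (auto simp: c2)
  let ?F = "\<lambda>\<theta> A. Finite_Set.fold (\<lambda>i. \<delta> i ^^ Poly_Mapping.lookup \<theta> i) a A"
  let ?e = "Poly_Mapping.single i 1 + \<theta>"
  \<comment> \<open>Commutation allows the index \<open>i\<close> to be applied last; the rest of
    the fold does not see the exponent at \<open>i\<close>, the only one that changes.\<close>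
  have rec: "?F \<theta> UNIV = (\<delta> i ^^ Poly_Mapping.lookup \<theta> i) (?F \<theta> (UNIV - {i}))" for \<theta>
  proof -
    interpret comp_fun_commute "\<lambda>i. \<delta> i ^^ Poly_Mapping.lookup \<theta> i" by (rule cf)
    show ?thesis by (rule fold_rec) auto
  qed
  have "?F ?e (UNIV - {i}) = ?F \<theta> (UNIV - {i})"
    by (rule fold_closed_eq[where B = UNIV]) (auto simp: lookup_add lookup_single)
  then show ?thesis
    unfolding op_action_def rec[of ?e] rec[of \<theta>] by (simp add: lookup_add)
qed

section \<open>Evaluation at a differential point\<close>

definition eval_mon :: "('v \<Rightarrow> 'k) \<Rightarrow> ('v \<Rightarrow>\<^sub>0 nat) \<Rightarrow> 'k::comm_ring_1" where
  "eval_mon e m = (\<Prod>u\<in>Poly_Mapping.keys m. e u ^ Poly_Mapping.lookup m u)"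

definition eval_at :: "('v \<Rightarrow> 'k) \<Rightarrow> (('v \<Rightarrow>\<^sub>0 nat) \<Rightarrow>\<^sub>0 'k) \<Rightarrow> 'k::comm_ring_1" where
  "eval_at e f = (\<Sum>m\<in>Poly_Mapping.keys f. Poly_Mapping.lookup f m * eval_mon e m)"

lemma eval_mon_eq:
  assumes "finite K" "Poly_Mapping.keys m \<subseteq> K"
  shows "eval_mon e m = (\<Prod>u\<in>K. e u ^ Poly_Mapping.lookup m u)"
  unfolding eval_mon_def using assms
  by (intro prod.mono_neutral_left) (auto simp: in_keys_iff)

lemma eval_mon_add: "eval_mon e (m + n) = eval_mon e m * eval_mon e n"
proof -
  let ?K = "Poly_Mapping.keys m \<union> Poly_Mapping.keys n"
  have "eval_mon e m = (\<Prod>u\<in>?K. e u ^ Poly_Mapping.lookup m u)"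
    "eval_mon e n = (\<Prod>u\<in>?K. e u ^ Poly_Mapping.lookup n u)"
    "eval_mon e (m + n) = (\<Prod>u\<in>?K. e u ^ Poly_Mapping.lookup (m + n) u)"
    using Poly_Mapping.keys_add[of m n] by (intro eval_mon_eq; auto)+
  then show ?thesis by (simp add: lookup_add power_add prod.distrib)
qed

lemma eval_at_0 [simp]: "eval_at e 0 = 0"
  by (simp add: eval_at_def)

lemma eval_at_single [simp]: "eval_at e (Poly_Mapping.single m c) = c * eval_mon e m"
  by (simp add: eval_at_def)

lemma eval_at_add: "eval_at e (f + g) = eval_at e f + eval_at e g"
  unfolding eval_at_def
  by (rule setsum_keys_plus_distrib[of "\<lambda>m c. c * eval_mon e m"]) (auto simp: algebra_simps)

lemma eval_at_sum: "eval_at e (\<Sum>x\<in>X. h x) = (\<Sum>x\<in>X. eval_at e (h x))"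
  by (induction X rule: infinite_finite_induct) (simp_all add: eval_at_add)

lemma eval_at_mult: "eval_at e (f * g) = eval_at e f * eval_at e g"
proof (induction f rule: poly_mapping_induct)
  case (single m c)
  show ?case
    by (induction g rule: poly_mapping_induct)
      (simp_all add: mult_single eval_mon_add eval_at_add algebra_simps)
qed (simp_all add: eval_at_add distrib_right)

lemma eval_mon_zero [simp]: "eval_mon e 0 = 1"
  by (simp add: eval_mon_def)

lemma eval_mon_var [simp]: "eval_mon e (Poly_Mapping.single u (Suc 0)) = e u"
  by (simp add: eval_mon_def)

lemma partial_deriv_eq_0: "u \<notin> vars f \<Longrightarrow> partial_deriv u f = 0"
  unfolding partial_deriv_def by (rule sum.neutral) (auto simp: vars_def in_keys_iff)

lemma partial_deriv_add: "partial_deriv u (f + g) = partial_deriv u f + partial_deriv u g"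
  unfolding partial_deriv_def
  by (rule setsum_keys_plus_distrib[of "\<lambda>m c. Poly_Mapping.single (m - Poly_Mapping.single u 1)
      (of_nat (Poly_Mapping.lookup m u) * c)"]) (auto simp: algebra_simps single_add)

lemma partial_deriv_single:
  "partial_deriv u (Poly_Mapping.single m c) =
    Poly_Mapping.single (m - Poly_Mapping.single u 1) (of_nat (Poly_Mapping.lookup m u) * c)"
  by (simp add: partial_deriv_def)

text \<open>The defining sum runs over the variables of \<open>f\<close> itself; a common finite
  index set makes the sums for different polynomials comparable.\<close>

lemma dderiv_eq:
  assumes "finite V" "vars f \<subseteq> V"
  shows "dderiv \<delta> i f = Poly_Mapping.map (\<delta> i) f +
    (\<Sum>u\<in>V. partial_deriv u f * Var (apply_op (Poly_Mapping.single i 1) u))"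
  unfolding dderiv_def using assms
  by (intro arg_cong2[of _ _ _ _ "(+)"] sum.mono_neutral_left) (auto simp: partial_deriv_eq_0)

lemma poly_mapping_map_add:
  assumes "derivation D"
  shows "Poly_Mapping.map D (f + g) = Poly_Mapping.map D f + Poly_Mapping.map (D :: 'a::comm_ring_1 \<Rightarrow> 'a) g"
  by (rule poly_mapping_eqI)
    (auto simp: map.rep_eq lookup_add when_def derivation_0[OF assms]
      simp flip: derivation_add[OF assms])

lemma dderiv_add:
  assumes "derivation (\<delta> i)"
  shows "dderiv \<delta> i (f + g) = dderiv \<delta> i f + dderiv \<delta> i (g :: ('d, 'y, 'k::comm_ring_1) dpoly)"
proof -
  let ?V = "vars f \<union> vars g"
  have "dderiv \<delta> i h = Poly_Mapping.map (\<delta> i) h +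
      (\<Sum>u\<in>?V. partial_deriv u h * Var (apply_op (Poly_Mapping.single i 1) u))"
    if "h \<in> {f, g, f + g}" for h
    using that vars_add[of f g] by (intro dderiv_eq) auto
  then show ?thesis
    by (simp add: poly_mapping_map_add[OF assms] partial_deriv_add distrib_right sum.distrib)
qed

text \<open>On a single term the chain rule defining \<open>dderiv\<close> becomes, after
  evaluation, the Leibniz rule for a product of powers in \<open>k\<close>; the hypothesis on
  \<open>e\<close> supplies the inner derivatives.\<close>

lemma eval_at_dderiv:
  fixes f :: "('d, 'y, 'k::comm_ring_1) dpoly"
  assumes D: "derivation (\<delta> i)"
    and e: "\<And>u. e (apply_op (Poly_Mapping.single i 1) u) = \<delta> i (e u)"
  shows "eval_at e (dderiv \<delta> i f) = \<delta> i (eval_at e f)"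
proof (induction f rule: poly_mapping_induct)
  case zero
  have "dderiv \<delta> i (0 :: ('d, 'y, 'k) dpoly) = 0"
    using dderiv_add[of \<delta> i, OF D, of 0 0] by simp
  then show ?case by (simp add: derivation_0[OF D])
next
  case (single m c)
  let ?K = "Poly_Mapping.keys m"
  have "vars (Poly_Mapping.single m c) \<subseteq> ?K" by (auto simp: vars_def split: if_splits)
  then have "dderiv \<delta> i (Poly_Mapping.single m c) = Poly_Mapping.single m (\<delta> i c) +
      (\<Sum>u\<in>?K. Poly_Mapping.single (m - Poly_Mapping.single u 1) (of_nat (Poly_Mapping.lookup m u) * c) *
        Var (apply_op (Poly_Mapping.single i 1) u))"
    using dderiv_eq[of ?K "Poly_Mapping.single m c" \<delta> i]
    by (simp add: partial_deriv_single derivation_0[OF D])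
  then have "eval_at e (dderiv \<delta> i (Poly_Mapping.single m c)) = \<delta> i c * eval_mon e m +
      (\<Sum>u\<in>?K. of_nat (Poly_Mapping.lookup m u) * c * eval_mon e (m - Poly_Mapping.single u 1) * \<delta> i (e u))"
    by (simp add: eval_at_add eval_at_sum eval_at_mult Var_def e[simplified])
  also have "(\<Sum>u\<in>?K. of_nat (Poly_Mapping.lookup m u) * c * eval_mon e (m - Poly_Mapping.single u 1) * \<delta>
      i (e u))
      = (\<Sum>u\<in>?K. c * (\<delta> i (e u ^ Poly_Mapping.lookup m u) *
          (\<Prod>v\<in>?K - {u}. e v ^ Poly_Mapping.lookup m v)))"
  proof (rule sum.cong[OF refl])
    fix u assume u: "u \<in> ?K"
    have "eval_mon e (m - Poly_Mapping.single u 1) =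
        (\<Prod>v\<in>?K. e v ^ Poly_Mapping.lookup (m - Poly_Mapping.single u 1) v)"
      by (rule eval_mon_eq) (auto simp: in_keys_iff lookup_minus)
    also have "\<dots> = e u ^ (Poly_Mapping.lookup m u - 1) *
        (\<Prod>v\<in>?K - {u}. e v ^ Poly_Mapping.lookup (m - Poly_Mapping.single u 1) v)"
      using u by (subst prod.remove[of _ u]) (auto simp: lookup_minus)
    also have "(\<Prod>v\<in>?K - {u}. e v ^ Poly_Mapping.lookup (m - Poly_Mapping.single u 1) v) =
        (\<Prod>v\<in>?K - {u}. e v ^ Poly_Mapping.lookup m v)"
      by (rule prod.cong) (auto simp: lookup_minus lookup_single)
    finally show "of_nat (Poly_Mapping.lookup m u) * c * eval_mon e (m - Poly_Mapping.single u 1) * \<delta> i (e u)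
      = c * (\<delta> i (e u ^ Poly_Mapping.lookup m u) * (\<Prod>v\<in>?K - {u}. e v ^ Poly_Mapping.lookup m v))"
      by (simp add: derivation_power[OF D] ac_simps)
  qed
  also have "\<delta> i c * eval_mon e m + \<dots> = \<delta> i (c * eval_mon e m)"
    unfolding eval_mon_def
    by (simp add: derivation_mult[OF D] derivation_prod[OF D] sum_distrib_left)
  finally show ?case by simp
next
  case (add f g)
  then show ?case by (simp add: eval_at_add dderiv_add[of \<delta> i, OF D] derivation_add[OF D])
qed

text \<open>A compatible point gives a differential homomorphism to \<open>k\<close>. Its kernel
  bounds \<open>[A]\<close> from above as soon as \<open>A\<close> vanishes at the point.\<close>

lemma eval_kernel_differential_ideal:
  assumes "\<And>i. derivation (\<delta> i)"
    and "\<And>i u. e (apply_op (Poly_Mapping.single i 1) u) = \<delta> i (e u)"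
  shows "differential_ideal \<delta> {f :: ('d, 'y, 'k::comm_ring_1) dpoly. eval_at e f = 0}"
  using assms
  by (simp add: differential_ideal_def eval_at_add eval_at_mult eval_at_dderiv derivation_0)

section \<open>Characteristic sets of the unit ideal\<close>

lemma reduced_wrt_Var:
  assumes "ranking le" and "a \<notin> constants"
    and "\<not> reduced_wrt le (Var (0, y) :: ('d, 'y, 'k::zero_neq_one) dpoly) a"
  shows "leader le a = (0, y) \<and> deg_in (0, y) a = 1"
proof -
  let ?X = "Var (0, y) :: ('d, 'y, 'k) dpoly"
  have vX: "vars ?X = {(0, y)}" by (simp add: Var_def vars_def)
  have pos: "deg_in (leader le a) a > 0"
    using leader_props(1)[OF assms(1,2)] by (simp add: in_vars_iff)
  have "\<theta> = 0" if "apply_op \<theta> (leader le a) \<in> vars ?X" for \<theta>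
  proof -
    have "\<theta> + fst (leader le a) = 0" using that vX by (auto simp: apply_op_def)
    then have "Poly_Mapping.lookup \<theta> k + Poly_Mapping.lookup (fst (leader le a)) k = 0" for k
      by (metis lookup_add lookup_zero)
    then show ?thesis by (intro poly_mapping_eqI) simp
  qed
  \<comment> \<open>An indeterminate is no proper derivative of anything, so reducedness can fail
    only through the degree.\<close>
  then have le: "deg_in (leader le a) a \<le> deg_in (leader le a) ?X"
    using assms(3) unfolding reduced_wrt_def by auto
  then have "leader le a \<in> vars ?X" using pos by (simp add: in_vars_iff)
  then have l: "leader le a = (0, y)" using vX by simp
  moreover have "deg_in (0, y) ?X \<le> 1" by (simp add: deg_in_le_iff Var_def)
  ultimately show ?thesis using le pos by auto
qed

lemma linear_single_variable:
  fixes a :: "('d, 'y, 'k::comm_monoid_add) dpoly"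
  assumes "vars a \<subseteq> {u}" "deg_in u a = 1"
  shows "\<exists>c b. c \<noteq> 0 \<and> a = Poly_Mapping.single (Poly_Mapping.single u 1) c + Poly_Mapping.single 0 b"
proof -
  let ?m = "Poly_Mapping.single u 1 :: ('d, 'y) power_prod"
  have m: "m = 0 \<or> m = ?m" if "m \<in> Poly_Mapping.keys a" for m
  proof -
    have k: "Poly_Mapping.keys m \<subseteq> {u}" using that assms(1) by (auto simp: vars_def)
    have "Poly_Mapping.lookup m u \<le> 1" using that assms(2) deg_in_le_iff[of u a 1] by auto
    moreover have "m = Poly_Mapping.single u (Poly_Mapping.lookup m u)"
    proof (rule poly_mapping_eqI)
      fix v
      show "Poly_Mapping.lookup m v = Poly_Mapping.lookup (Poly_Mapping.single u (Poly_Mapping.lookup m u)) v"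
        using k by (cases "v = u") (auto simp: lookup_single in_keys_iff)
    qed
    ultimately show ?thesis by (metis One_nat_def le_SucE le_zero_eq single_zero)
  qed
  have ne: "?m \<noteq> 0" by (metis lookup_single_eq lookup_zero zero_neq_one)
  have "a = Poly_Mapping.single ?m (Poly_Mapping.lookup a ?m) + Poly_Mapping.single 0 (Poly_Mapping.lookup a 0)"
  proof (rule poly_mapping_eqI)
    fix m
    show "Poly_Mapping.lookup a m = Poly_Mapping.lookup (Poly_Mapping.single ?m (Poly_Mapping.lookup a ?m)
      + Poly_Mapping.single 0 (Poly_Mapping.lookup a 0)) m"
      using m[of m] ne by (cases "m = 0"; cases "m = ?m") (auto simp: lookup_add lookup_single in_keys_iff)
  qed
  moreover have "Poly_Mapping.lookup a ?m \<noteq> 0"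
  proof
    assume "Poly_Mapping.lookup a ?m = 0"
    then have "\<forall>m\<in>Poly_Mapping.keys a. m = 0" using m by (auto simp: in_keys_iff)
    then have "deg_in u a \<le> 0" unfolding deg_in_le_iff by (metis le_zero_eq lookup_zero)
    with assms(2) show False by simp
  qed
  ultimately show ?thesis by blast
qed

text \<open>Every indeterminate lies in the unit ideal without being constant, so it cannot be
  reduced and must be the leader of a linear element of \<open>A\<close>. Thus all differential
  variables are derivatives of leaders, and autoreducedness leaves each element only its own
  leader.\<close>

lemma characteristic_set_UNIV:
  fixes A :: "('d::finite, 'y::finite, 'k::zero_neq_one) dpoly set"
  assumes r: "ranking le" and A: "characteristic_set le UNIV A" and b: "b \<in> A"
  shows "vars b = {leader le b}" "fst (leader le b) = 0" "deg_in (leader le b) b = 1"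
proof -
  have auto: "autoreduced le A" using A by (simp add: characteristic_set_def)
  have ex: "\<exists>a\<in>A. leader le a = (0, y) \<and> deg_in (0, y) a = 1" for y
  proof -
    let ?X = "Var (0, y) :: ('d, 'y, 'k) dpoly"
    have "vars ?X \<noteq> {}" by (simp add: Var_def vars_def)
    then have "\<exists>a\<in>A. \<not> reduced_wrt le ?X a"
      using reduced_in_constants[OF r A, of ?X] by (auto simp: vars_eq_empty_iff)
    then show ?thesis using reduced_wrt_Var[OF r autoreduced_not_const[OF auto]] by blast
  qed
  \<comment> \<open>The variable \<open>v\<close> is a derivative of the leader of some
    \<open>a\<close>. If \<open>b\<close> were not \<open>a\<close>, reducedness would exclude both
    a proper derivative and that leader, where the degree must stay below 1. So
    \<open>b = a\<close>, and its leader is its highest variable.\<close>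
  have key: "leader le b = (0, snd v) \<and> deg_in (0, snd v) b = 1 \<and> v = (0, snd v)" if v: "v \<in> vars b" for v
  proof -
    obtain a where a: "a \<in> A" "leader le a = (0, snd v)" "deg_in (0, snd v) a = 1" using ex by blast
    have va: "v = apply_op (fst v) (0, snd v)" by (simp add: apply_op_def)
    have "b = a"
    proof (rule ccontr)
      assume "b \<noteq> a"
      note ar = autoreducedD[OF auto b a(1) this, unfolded a]
      show False
      proof (cases "fst v = 0")
        case True
        then have "v = (0, snd v)" by (simp add: prod_eq_iff)
        with ar(2) v show False by (simp add: in_vars_iff)
      next
        case False
        from ar(1)[OF this] va v show False by simp
      qed
    qed
    moreover have "fst v = 0"
      using leader_props(2)[OF r autoreduced_not_const[OF auto b] v] \<open>b = a\<close> a(2) va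
        proper_derivative_not_le[OF r, of "fst v" "(0, snd v)"] by auto
    then have "v = (0, snd v)" by (simp add: prod_eq_iff)
    ultimately show ?thesis using a by simp
  qed
  have l: "leader le b \<in> vars b" by (rule leader_props(1)[OF r autoreduced_not_const[OF auto b]])
  have lk: "leader le b = (0, snd (leader le b))" "deg_in (0, snd (leader le b)) b = 1"
    using key[OF l] by blast+
  then show "fst (leader le b) = 0" "deg_in (leader le b) b = 1" by (metis fst_conv, metis)
  show "vars b = {leader le b}" 
  proof -
    have "v = leader le b" if "v \<in> vars b" for v using key[OF that] by metis
    then show ?thesis using l by blast
  qed
qed

lemma prod_nonzero_constants:
  fixes h :: "'a \<Rightarrow> ('d, 'y, 'k::field) dpoly"
  assumes "\<And>a. a \<in> A \<Longrightarrow> \<exists>c. c \<noteq> 0 \<and> h a = Const c"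
  shows "\<exists>c. c \<noteq> 0 \<and> prod h A = Const c"
  using assms
proof (induction A rule: infinite_finite_induct)
  case (insert x A)
  then obtain c d where "c \<noteq> 0" "h x = Const c" "d \<noteq> 0" "prod h A = Const d" by (meson insertCI)
  then show ?case using insert.hyps by (intro exI[of _ "c * d"]) (simp add: Const_mult)
qed (auto intro!: exI[of _ 1])

text \<open>
  If \<open>I\<close> is the whole ring, then \<open>\<A>\<close> consists of one polynomial \<open>c y + b\<close> with constant \<open>c, b\<close> for each
  indeterminate \<open>y\<close>; its differential zero \<open>y = - b / c\<close> shows \<open>1 \<notin> [\<A>]\<close>, while \<open>H\<^sub>\<A>\<close>
  is a nonzero constant.
\<close>

lemma characterizable_proper:
  fixes \<delta> :: "'d::finite \<Rightarrow> 'k::field \<Rightarrow> 'k"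
    and le :: "('d, 'y::finite) dvar \<Rightarrow> ('d, 'y) dvar \<Rightarrow> bool"
  assumes D: "\<And>i. derivation (\<delta> i)"
    and comm: "\<And>i j a. \<delta> i (\<delta> j a) = \<delta> j (\<delta> i a)"
    and r: "ranking le" and "characterizable \<delta> le I"
  shows "1 \<notin> I"
proof
  assume "1 \<in> I"
  obtain A where A: "characteristic_set le I A"
    and I: "I = saturation (diff_ideal_gen \<delta> A) (init_sep_prod le A)" and di: "differential_ideal \<delta> I"
    using assms(4) by (auto simp: characterizable_def)
  have "f \<in> I" for f using di \<open>1 \<in> I\<close> unfolding differential_ideal_def by (metis mult_1_right)
  then have "I = UNIV" by blast
  with A have AU: "characteristic_set le UNIV A" by simp
  have inj: "inj_on (leader le) A"
    using A autoreduced_leader_inj by (auto simp: characteristic_set_def)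
  let ?m = "\<lambda>u. Poly_Mapping.single u 1 :: ('d, 'y) power_prod"
  have lin: "\<exists>c b. c \<noteq> 0 \<and> a = Poly_Mapping.single (?m (leader le a)) c + Poly_Mapping.single 0 b"
    if "a \<in> A" for a
    using characteristic_set_UNIV[OF r AU that] by (intro linear_single_variable) auto
  have ne: "?m u \<noteq> 0" for u by (metis lookup_single_eq lookup_zero zero_neq_one)
  \<comment> \<open>For a linear polynomial with leading coefficient \<open>c\<close>, both the
    initial and the separant are \<open>c\<close>.\<close>
  have "\<exists>c. c \<noteq> 0 \<and> initial le a * separant le a = Const c" if a: "a \<in> A" for a
  proof -
    obtain c b where cb: "c \<noteq> 0" "a = Poly_Mapping.single (?m (leader le a)) c + Poly_Mapping.single 0 b"
      using lin[OF a] by blast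
    have "initial le a = coeff_in (leader le a) 1 a"
      using characteristic_set_UNIV(3)[OF r AU a] by (simp add: initial_def)
    also have "\<dots> = coeff_in (leader le a) 1
        (Poly_Mapping.single (?m (leader le a)) c + Poly_Mapping.single 0 b)"
      by (rule arg_cong[OF cb(2)])
    also have "\<dots> = Const c" by (simp add: coeff_in_add coeff_in_single Const_def)
    finally have "initial le a = Const c" .
    moreover have "separant le a = partial_deriv (leader le a)
        (Poly_Mapping.single (?m (leader le a)) c + Poly_Mapping.single 0 b)"
      unfolding separant_def by (rule arg_cong[OF cb(2)])
    then have "separant le a = Const c"
      by (simp add: partial_deriv_add partial_deriv_single Const_def)
    ultimately have "initial le a * separant le a = Const (c * c)" by (simp only: Const_mult)
    moreover have "c * c \<noteq> 0" using cb(1) by simp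
    ultimately show ?thesis by blast
  qed
  then have "\<exists>h. h \<noteq> 0 \<and> init_sep_prod le A = Const h"
    unfolding init_sep_prod_def by (rule prod_nonzero_constants)
  then obtain h where h: "h \<noteq> 0" "init_sep_prod le A = Const h" by blast
  \<comment> \<open>The root of the linear element of \<open>A\<close> with leader \<open>y\<close>,
    which \<open>inv_into\<close> finds because leaders are injective; only values at leaders
    matter.\<close>
  define s where "s y = (let a = inv_into A (leader le) (0, y) in
    - Poly_Mapping.lookup a 0 / Poly_Mapping.lookup a (?m (0, y)))" for y
  \<comment> \<open>The values at proper derivatives are forced by compatibility with the
    derivations.\<close>
  define e where "e u = op_action \<delta> (fst u) (s (snd u))" for u :: "('d, 'y) dvar"
  have e: "e (apply_op (Poly_Mapping.single i 1) u) = \<delta> i (e u)" for i u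
    using op_action_Suc[of \<delta> i "fst u" "s (snd u)"] comm by (simp add: e_def apply_op_def)
  have "eval_at e a = 0" if a: "a \<in> A" for a
  proof -
    obtain c b where cb: "c \<noteq> 0" "a = Poly_Mapping.single (?m (leader le a)) c + Poly_Mapping.single 0 b"
      using lin[OF a] by blast
    obtain y where y: "leader le a = (0, y)"
      using characteristic_set_UNIV(2)[OF r AU a] by (metis prod.collapse)
    have "inv_into A (leader le) (0, y) = a" using inv_into_f_f[OF inj a] y by simp
    moreover have "Poly_Mapping.lookup a 0 = b" "Poly_Mapping.lookup a (?m (0, y)) = c"
      using ne[of "(0, y)"] by (subst cb(2), simp add: y lookup_add lookup_single)+
    ultimately have "s y = - b / c" by (simp add: s_def)
    then have "e (0, y) = - b / c" by (simp add: e_def op_action_0)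
    moreover have "eval_at e a = c * e (0, y) + b"
      by (subst cb(2)) (simp add: y eval_at_add)
    ultimately show ?thesis using cb(1) by simp
  qed
  then have "diff_ideal_gen \<delta> A \<subseteq> {f. eval_at e f = 0}"
    unfolding diff_ideal_gen_def
    by (intro hull_minimal eval_kernel_differential_ideal) (use D e in auto)
  \<comment> \<open>Membership of 1 in the saturation puts a power of the nonzero constant
    \<open>h\<close> into \<open>[A]\<close>, although evaluation at \<open>e\<close> does not send
    it to 0.\<close>
  moreover obtain n where "init_sep_prod le A ^ n * 1 \<in> diff_ideal_gen \<delta> A"
    using \<open>1 \<in> I\<close> I by (auto simp: saturation_def)
  ultimately have "eval_at e (Const h ^ n) = 0" using h(2) by auto
  moreover have "(Const h :: ('d, 'y, 'k) dpoly) ^ n = Const (h ^ n)" by (induction n) (simp_all add: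
      Const_mult)
  ultimately have "eval_at e (Const (h ^ n)) = 0" by simp
  then show False using h(1) by (simp add: Const_def)
qed

section \<open>Uniqueness\<close>

lemma deg_in_mult_free:
  "u \<notin> vars f \<Longrightarrow> deg_in u (f * g) \<le> deg_in u (g :: ('d, 'y, 'k::comm_ring_1) dpoly)"
  using deg_in_mult_le[of u f g] by (simp add: not_in_vars_iff)

lemma derivative_not_in_non_leaders:
  "apply_op \<theta> (leader le f) \<in> vars g \<Longrightarrow> f \<in> C \<Longrightarrow> g \<notin> polys_in (non_leaders le C)"
  unfolding polys_in_def non_leaders_def by blast

text \<open>The cross combination is reduced because the initials lie in \<open>k[N]\<close> and the leading terms cancel.\<close>

lemma cross_combination_reduced:
  fixes f g :: "('d, 'y, 'k::comm_ring_1) dpoly"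
  assumes r: "ranking le" and aC: "autoreduced le C" and aD: "autoreduced le D"
    and f: "f \<in> C" and g: "g \<in> D" and rk: "rank le g = rank le f"
    and N: "initial le f \<in> polys_in (non_leaders le C)" "initial le g \<in> polys_in (non_leaders le C)"
    and a: "a \<in> C" and a': "a' \<in> D" "rank le a' = rank le a"
  shows "reduced_wrt le (initial le g * f - initial le f * g) a"
proof -
  let ?u = "leader le a" and ?h = "initial le g * f - initial le f * g"
  have la: "leader le a' = ?u" "deg_in ?u a' = deg_in ?u a"
    using a'(2) unfolding rank_def by (metis prod.inject)+
  have lf: "leader le g = leader le f" "deg_in (leader le f) g = deg_in (leader le f) f"
    using rk unfolding rank_def by (metis prod.inject)+
  \<comment> \<open>The case distinctions for \<open>f\<close> in \<open>C\<close> and for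
    \<open>g\<close> in \<open>D\<close> run in parallel, because leaders identify elements within
    each set.\<close>
  have eq: "a' = g \<longleftrightarrow> a = f"
  proof
    assume "a' = g"
    then have "leader le a = leader le f" using la lf by simp
    then show "a = f" using autoreduced_leader_inj[OF aC] a f by (simp add: inj_on_eq_iff)
  next
    assume "a = f"
    then have "leader le a' = leader le g" using la lf by simp
    then show "a' = g" using autoreduced_leader_inj[OF aD] a' g by (simp add: inj_on_eq_iff)
  qed
  have free: "apply_op \<theta> ?u \<notin> vars (initial le f)" "apply_op \<theta> ?u \<notin> vars (initial le g)" for \<theta>
    using N derivative_not_in_non_leaders[OF _ a] by blast+
  have "apply_op 0 ?u = ?u" by simp
  then have free0: "?u \<notin> vars (initial le f)" "?u \<notin> vars (initial le g)" using free[of 0] by metis+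
  have proper: "apply_op \<theta> (leader le p) \<notin> vars p" if "p \<notin> constants" "\<theta> \<noteq> 0" for \<theta> and p :: "('d, 'y,
      'k) dpoly"
    using leader_props(2)[OF r that(1)] proper_derivative_not_le[OF r that(2)] by blast
  have "apply_op \<theta> ?u \<notin> vars ?h" if "\<theta> \<noteq> 0" for \<theta>
  proof -
    have "apply_op \<theta> ?u \<notin> vars f"
      using autoreducedD(1)[OF aC f a _ that] proper[OF autoreduced_not_const[OF aC f] that] by metis
    \<comment> \<open>Since \<open>g\<close> belongs to \<open>D\<close>, reducedness is available
      against \<open>a'\<close> only; this suffices because \<open>a'\<close> and \<open>a\<close>
      share their leader.\<close>
    moreover have "apply_op \<theta> (leader le a') \<notin> vars g"
      using autoreducedD(1)[OF aD g a'(1) _ that] proper[OF autoreduced_not_const[OF aD g] that] by metis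
    ultimately show ?thesis
      using free[of \<theta>] vars_diff[of "initial le g * f" "initial le f * g"]
        vars_mult[of "initial le g" f] vars_mult[of "initial le f" g]
      unfolding la by blast
  qed
  moreover have "deg_in ?u ?h < deg_in ?u a"
  proof (cases "a = f")
    case False
    then have "deg_in ?u f < deg_in ?u a" "deg_in ?u g < deg_in ?u a"
      using autoreducedD(2)[OF aC f a] autoreducedD(2)[OF aD g a'(1)] eq la by auto
    then show ?thesis
      using deg_in_diff_le[of ?u "initial le g * f" "initial le f * g"]
        deg_in_mult_free[OF free0(2), of f] deg_in_mult_free[OF free0(1), of g] by linarith
  next
    case True
    have pos: "deg_in ?u f > 0"
      using leader_props(1)[OF r autoreduced_not_const[OF aC f]] True by (simp add: in_vars_iff)
    have "coeff_in ?u i ?h = 0" if "deg_in ?u f \<le> i" for i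
    proof (cases "i = deg_in ?u f")
      \<comment> \<open>The initials are free of \<open>?u\<close>, so both products have the top
        coefficient \<open>initial le f * initial le g\<close>.\<close>
      case eqi: True
      have "coeff_in ?u i f = initial le f" "coeff_in ?u i g = initial le g"
        using True lf eqi by (simp_all add: initial_def)
      then show ?thesis
        using mult.commute[of "initial le f" "initial le g"]
        by (simp add: coeff_in_diff coeff_in_mult_free free0)
    next
      case False
      then have "coeff_in ?u i f = 0" "coeff_in ?u i g = 0"
        using that True lf by (auto intro!: coeff_in_above_deg)
      then show ?thesis by (simp add: coeff_in_diff coeff_in_mult_free free0)
    qed
    then show ?thesis using True deg_in_less_iff_coeff[OF pos, of ?u ?h] by simp
  qed
  ultimately show ?thesis by (simp add: reduced_wrt_def)
qed

section \<open>Normalization and comparison of canonical sets\<close>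

lemma lookup_Const_mult: "Poly_Mapping.lookup (Const c * f) m = c * Poly_Mapping.lookup f m"
  for c :: "'k::comm_ring_1"
proof (induction f rule: poly_mapping_induct)
  case (single n d)
  then show ?case by (simp add: Const_def mult_single lookup_single when_def)
qed (simp_all add: distrib_left lookup_add)

text \<open>The leading monomial depends only on the set of monomials, which a nonzero scalar
  preserves.\<close>

lemma lex_leading_coeff_Const_mult:
  assumes "c \<noteq> (0 :: 'k::field)"
  shows "lex_leading_coeff le (Const c * f) = c * lex_leading_coeff le f"
proof -
  have "Poly_Mapping.keys (Const c * f) = Poly_Mapping.keys f"
    using assms by (auto simp: in_keys_iff lookup_Const_mult)
  then show ?thesis
    by (simp add: lex_leading_coeff_def lex_leading_monomial_def lookup_Const_mult)
qed

text \<open>Mutual divisors differ by a unit, that is, by a nonzero constant, and comparing leading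
  coefficients makes this constant 1.\<close>

lemma associated_monic_eq:
  fixes p q :: "('d, 'y, 'k::field) dpoly"
  assumes "p dvd q" "q dvd p" "p \<noteq> 0" "q \<noteq> 0"
    and "lex_leading_coeff le p = 1" "lex_leading_coeff le q = 1"
  shows "p = q"
proof -
  obtain s where s: "q = p * s" using assms(1) by (rule dvdE)
  obtain t where t: "p = q * t" using assms(2) by (rule dvdE)
  have "p * 1 = p * (s * t)" using s t by (metis mult.assoc mult_1_right)
  then have "1 = s * t" by (rule mpoly_mult_left_cancel[OF assms(3)])
  then have "s dvd 1" by (rule dvdI)
  then obtain c where c: "s = Const c" "c \<noteq> 0" by (auto simp: unit_iff_constant constants_def)
  then have "q = Const c * p" using s by (simp add: mult.commute)
  then have "c = 1" using lex_leading_coeff_Const_mult[OF c(2), of le p] assms(5,6) by simp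
  with \<open>q = Const c * p\<close> show ?thesis by simp
qed

lemma proportional_primitive_eq:
  fixes f g p q :: "('d, 'y, 'k::field) dpoly"
  assumes eq: "q * f = p * g" and nz: "p \<noteq> 0" "q \<noteq> 0"
    and N: "p \<in> polys_in N" "q \<in> polys_in N"
    and prim: "\<And>h. h \<in> polys_in N \<Longrightarrow> h dvd f \<Longrightarrow> h \<in> constants"
      "\<And>h. h \<in> polys_in N \<Longrightarrow> h dvd g \<Longrightarrow> h \<in> constants"
    and lc: "lex_leading_coeff le p = 1" "lex_leading_coeff le q = 1"
  shows "f = g"
proof -
  have "p dvd q * f" "q dvd p * g" using eq by (metis dvd_triv_left)+
  \<comment> \<open>A divisor of \<open>p\<close> lies in \<open>k[N]\<close> together with
    \<open>p\<close>; if it also divides \<open>f\<close>, it is constant. So \<open>p\<close> has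
    no common factor with \<open>f\<close>, nor \<open>q\<close> with \<open>g\<close>.\<close>
  then have "p dvd q" "q dvd p"
    using dvd_of_no_common_factor[of p q f] dvd_of_no_common_factor[of q p g] nz
      prim polys_in_dvd[OF _ nz(1) N(1)] polys_in_dvd[OF _ nz(2) N(2)] by blast+
  then have "p = q" using associated_monic_eq nz lc by blast
  then show ?thesis using eq mpoly_mult_left_cancel[OF nz(1)] by metis
qed

text \<open>Symmetric in \<open>C\<close> and \<open>D\<close>, so one inclusion is enough: every
  \<open>f\<close> in \<open>C\<close> equals the element of \<open>D\<close> of the same
  rank.\<close>

lemma canonical_subset:
  fixes I C D :: "('d::finite, 'y::finite, 'k::field) dpoly set"
  assumes r: "ranking le" and I: "differential_ideal \<delta> I" "1 \<notin> I"
    and C: "canonical_characteristic_set le I C" and D: "canonical_characteristic_set le I D"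
  shows "C \<subseteq> D"
proof
  fix f assume f: "f \<in> C"
  have csC: "characteristic_set le I C" and csD: "characteristic_set le I D"
    using C D by (auto simp: canonical_characteristic_set_def)
  have aC: "autoreduced le C" "C \<subseteq> I" and aD: "autoreduced le D" "D \<subseteq> I"
    using csC csD by (auto simp: characteristic_set_def)
  have ranks: "rank le ` C = rank le ` D" by (rule characteristic_sets_same_ranks[OF r csC csD])
  then have "fst ` rank le ` C = fst ` rank le ` D" by simp
  then have "leader le ` C = leader le ` D" by (simp add: image_image rank_def)
  moreover have "non_leaders le X = UNIV - (\<Union>u\<in>leader le ` X. range (\<lambda>\<theta>. apply_op \<theta> u))"
    for X :: "('d, 'y, 'k) dpoly set"
    unfolding non_leaders_def by blast
  ultimately have N: "non_leaders le D = non_leaders le C" by (simp only:)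
  obtain g where g: "g \<in> D" "rank le g = rank le f" using ranks f by (metis imageE image_eqI)
  let ?N = "polys_in (non_leaders le C) :: ('d, 'y, 'k) dpoly set"
  let ?p = "initial le f" and ?q = "initial le g"
  have fN: "?p \<in> ?N" "\<And>h. h \<in> ?N \<Longrightarrow> h dvd f \<Longrightarrow> h \<in> constants" "lex_leading_coeff le ?p = 1"
    using C f unfolding canonical_characteristic_set_def by blast+
  have gN: "?q \<in> ?N" "\<And>h. h \<in> ?N \<Longrightarrow> h dvd g \<Longrightarrow> h \<in> constants" "lex_leading_coeff le ?q = 1"
    using D g N unfolding canonical_characteristic_set_def by metis+
  have "reduced_wrt le (?q * f - ?p * g) a" if a: "a \<in> C" for a
  proof -
    obtain a' where "a' \<in> D" "rank le a' = rank le a" using ranks a by (metis imageE image_eqI)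
    then show ?thesis using cross_combination_reduced[OF r aC(1) aD(1) f g fN(1) gN(1) a] by blast
  qed
  moreover have in_I: "?q * f - ?p * g \<in> I"
  proof -
    have "?q * f + (- ?p) * g \<in> I"
      using I(1) f g aC(2) aD(2) unfolding differential_ideal_def by blast
    then show ?thesis by simp
  qed
  ultimately have "?q * f - ?p * g \<in> constants"
    using reduced_in_constants[OF r csC] by blast
  moreover have "\<not> ?q * f - ?p * g dvd 1"
  proof
    assume "?q * f - ?p * g dvd 1"
    then obtain t where "1 = t * (?q * f - ?p * g)" by (metis dvdE mult.commute)
    then show False using I in_I unfolding differential_ideal_def by metis
  qed
  ultimately have "?q * f = ?p * g" by (auto simp: unit_iff_constant)
  moreover have "?p \<noteq> 0" "?q \<noteq> 0"
    using f g(1) autoreduced_not_const[OF aC(1)] autoreduced_not_const[OF aD(1)]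
      vars_eq_empty_iff[of f] vars_eq_empty_iff[of g]
    unfolding initial_def by (metis lead_coeff_in_nonzero vars_zero)+
  ultimately have "f = g"
    using fN gN by (intro proportional_primitive_eq[of ?q f ?p g "non_leaders le C" le]) auto
  with g(1) show "f \<in> D" by simp
qed

theorem proposition3:
  fixes \<delta> :: "'d::finite \<Rightarrow> 'k::field_char_0 \<Rightarrow> 'k"
    and le :: "('d, 'y::finite) dvar \<Rightarrow> ('d, 'y) dvar \<Rightarrow> bool"
    and I C D :: "('d, 'y, 'k) dpoly set"
  assumes "\<And>i. derivation (\<delta> i)"
    and "\<And>i j a. \<delta> i (\<delta> j a) = \<delta> j (\<delta> i a)"
    and "ranking le"
    and "characterizable \<delta> le I"
    and "canonical_characteristic_set le I C"
    and "canonical_characteristic_set le I D"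
  shows "C = D"
proof
  have "1 \<notin> I" by (rule characterizable_proper[OF assms(1-4)])
  moreover have "differential_ideal \<delta> I" using assms(4) by (simp add: characterizable_def)
  ultimately show "C \<subseteq> D" "D \<subseteq> C"
    using canonical_subset[OF assms(3)] assms(5,6) by blast+
qed

end
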